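(* Let $p\ge 1$, let $\Psi$ be a positive definite $p\times p$ matrix, let $m\ge p$ be real and let $q\in\{1,2,3,\ldots\}$. Then the integral $$c_{m,q}=\int_{\mathcal P_p}\exp\Big(-\tfrac12\operatorname{tr}(B^{-q})\Big)\,|B|^{-qm/2-p/2-1/2}\,dB$$ is finite (and positive), and consequently the function $$B\mapsto \mathcal W^{-q}(B\mid\Psi,m)=\frac{1}{c_{m,q}}\exp\Big(-\tfrac12\operatorname{tr}\big((\Psi^{-1/2}B\Psi^{-1/2})^{-q}\big)\Big)\frac{|\Psi|^{qm/2}}{|B|^{qm/2+p/2+1/2}}$$ is a probability density on $\mathcal P_p$.
   Context: $\mathcal P_p$ denotes the set of (symmetric) positive definite $p\times p$ real matrices, and $dB$ denotes Lebesgue measure on the $p(p+1)/2$ functionally independent entries $(B_{ij})_{i\le j}$ of a symmetric matrix. $|B|$ is the determinant. For a positive definite matrix $C$, $C^{1/2}$ denotes its unique positive definite square root, $C^{-1/2}=(C^{1/2})^{-1}$, and $C^{-q}=(C^{-1})^q$. The distribution with this density is called the power inverse Wishart distribution with parameters $(\Psi,m,q)$; for $q=1$ it is the usual inverse Wishart distribution. *)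

theory Defs
  imports "HOL-Analysis.Analysis"
begin

text \<open>Matrices are p x p with p = CARD('n::{finite,linorder}); the index type carries a linear order so that
  the functionally independent entries (B i j) with i \<le> j can be singled out.\<close>

definition pos_def :: "real^'n::{finite,linorder}^'n::{finite,linorder} \<Rightarrow> bool" where
  "pos_def A \<longleftrightarrow> transpose A = A \<and> (\<forall>x. x \<noteq> 0 \<longrightarrow> x \<bullet> (A *v x) > 0)"

definition upper_idx :: "('n::{finite,linorder} \<times> 'n::{finite,linorder}) set" where
  "upper_idx = {(i, j). i \<le> j}"

definition sym_of :: "('n::{finite,linorder} \<times> 'n::{finite,linorder} \<Rightarrow> real) \<Rightarrow> real^'n::{finite,linorder}^'n::{finite,linorder}" where
  "sym_of v = (\<chi> i j. v (min i j, max i j))"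

definition sym_lebesgue :: "('n::{finite,linorder} \<times> 'n::{finite,linorder} \<Rightarrow> real) measure" where
  "sym_lebesgue = PiM upper_idx (\<lambda>_. lborel)"

definition PD_set :: "('n::{finite,linorder} \<times> 'n::{finite,linorder} \<Rightarrow> real) set" where
  "PD_set = {v \<in> space sym_lebesgue. pos_def (sym_of v)}"

primrec mpow :: "real^'n::{finite,linorder}^'n::{finite,linorder} \<Rightarrow> nat \<Rightarrow> real^'n::{finite,linorder}^'n::{finite,linorder}" where
  "mpow A 0 = mat 1"
| "mpow A (Suc k) = A ** mpow A k"

definition msqrt :: "real^'n::{finite,linorder}^'n::{finite,linorder} \<Rightarrow> real^'n::{finite,linorder}^'n::{finite,linorder}" where
  "msqrt C = (THE S. pos_def S \<and> S ** S = C)"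

definition cint :: "real \<Rightarrow> nat \<Rightarrow> ('n::{finite,linorder} \<times> 'n::{finite,linorder} \<Rightarrow> real) \<Rightarrow> real" where
  "cint m q v = exp (- trace (mpow (matrix_inv (sym_of v)) q) / 2)
     * det (sym_of v) powr (- (real q * m / 2) - real CARD('n::{finite,linorder}) / 2 - 1 / 2)"

definition cmq :: "real \<Rightarrow> nat \<Rightarrow> 'n::{finite,linorder} itself \<Rightarrow> ennreal" where
  "cmq m q _ = (\<integral>\<^sup>+ v. ennreal (cint m q v) * indicator (PD_set :: ('n::{finite,linorder} \<times> 'n::{finite,linorder} \<Rightarrow> real) set) v \<partial>sym_lebesgue)"

definition piw_density :: "real^'n::{finite,linorder}^'n::{finite,linorder} \<Rightarrow> real \<Rightarrow> nat \<Rightarrow> ('n::{finite,linorder} \<times> 'n::{finite,linorder} \<Rightarrow> real) \<Rightarrow> real" where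
  "piw_density Psi m q v =
     (1 / enn2real (cmq m q TYPE('n::{finite,linorder})))
     * exp (- trace (mpow (matrix_inv (matrix_inv (msqrt Psi) ** sym_of v ** matrix_inv (msqrt Psi))) q) / 2)
     * det Psi powr (real q * m / 2)
     / det (sym_of v) powr (real q * m / 2 + real CARD('n::{finite,linorder}) / 2 + 1 / 2)"

end

theory Submission
  imports Defs
begin

text \<open>If X is the inverse of B, then the trace of X^q is at least a constant plus trace X, while det X and
  det (1 + X) grow at most polynomially in trace X. Hence the integrand is dominated by a multiple of
  det (1 + B) to the power - (p + 1/2), whatever q is. That this power is integrable follows by
  induction on p: bordering a block B with a row b and a corner \<beta>, and writing b = (1 + B) c and
  \<beta> = \<gamma> + c \<bullet> b, the determinant of 1 + B gets multiplied by 1 + \<gamma>, the substitution contributes the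
  Jacobian det (1 + B), and positivity of the bordered matrix forces \<gamma> > |c|^2, so that
  (1 + \<gamma>) to the power - (p + 3/2) is at most (1 + \<gamma>) to the power - 3/2 times a product of
  one-dimensional Cauchy densities in the entries of c.

  The normalisation follows by substituting S B S for B, where S is the square root of \<Psi>; this map has
  Jacobian (det S) to the power p + 1 on symmetric matrices.\<close>

section \<open>Linear substitutions in product Lebesgue measures\<close>

text \<open>The exponent p + 1/2 is what the hypotheses supply, since m >= p and q >= 1 give qm/2 +
  p/2 + 1/2 >= p + 1/2, and it reproduces itself in the induction. A block of size p + 1 carries the
  exponent p + 3/2; the Jacobian det (1 + B) of b = (1 + B) c gives one power back, which leaves p +
  1/2 for B. Of the p + 3/2 powers of 1 + \<gamma>, one is spent on each entry of c and the
  remaining 3/2 make the tail in \<gamma> integrable. Passing from B to 1 + B removes the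
  singularity at the boundary of the cone, where negative powers of det B are unbounded. No
  eigenvalues occur: trace inequalities come from congruences of positive semidefinite matrices, the
  square root from a contraction, and Jacobians from elementary matrices. The positions (i, j) with
  i <= j are only part of a square array. Linear maps on them are extended by the identity to all
  positions, so that they have a square matrix and a determinant.\<close>

interpretation lborel_product: product_sigma_finite "\<lambda>_::'k. lborel :: real measure"
  by standard

abbreviation LP :: "'k set \<Rightarrow> ('k \<Rightarrow> real) measure" where
  "LP J \<equiv> PiM J (\<lambda>_. lborel)"

text \<open>Uniqueness of the product measure reduces the claim to boxes. It serves for
  transpositions of coordinates and for renaming the border positions \<open>(i, k)\<close> to
  \<open>i\<close>.\<close>

lemma nn_integral_PiM_reindex:
  fixes h :: "'k \<Rightarrow> 'l"
  assumes "finite I" "bij_betw h I K" and f: "f \<in> borel_measurable (LP I)"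
  shows "(\<integral>\<^sup>+x. f (\<lambda>i\<in>I. x (h i)) \<partial>LP K) = (\<integral>\<^sup>+x. f x \<partial>LP I)"
proof -
  have K: "finite K" "h ` I = K" "inj_on h I" using assms bij_betw_finite by (auto simp: bij_betw_def)
  have m: "(\<lambda>x. \<lambda>i\<in>I. x (h i)) \<in> LP K \<rightarrow>\<^sub>M LP I"
    using K by (intro measurable_restrict measurable_component_singleton) auto
  have "distr (LP K) (LP I) (\<lambda>x. \<lambda>i\<in>I. x (h i)) = LP I"
  proof (rule lborel_product.PiM_eqI)
    fix A :: "'k \<Rightarrow> real set" assume A: "\<And>i. i \<in> I \<Longrightarrow> A i \<in> sets lborel"
    let ?B = "\<lambda>l. A (inv_into I h l)"
    have eq: "(\<lambda>x. \<lambda>i\<in>I. x (h i)) -` Pi\<^sub>E I A \<inter> space (LP K) = Pi\<^sub>E K ?B"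
      using K by (auto simp: space_PiM PiE_iff extensional_def)
    have B: "?B l \<in> sets lborel" if "l \<in> K" for l using that K A by (auto simp: inv_into_into)
    have "emeasure (distr (LP K) (LP I) (\<lambda>x. \<lambda>i\<in>I. x (h i))) (Pi\<^sub>E I A) = emeasure (LP K) (Pi\<^sub>E K ?B)"
      using A by (subst emeasure_distr[OF m]) (auto simp: eq assms(1) intro!: sets_PiM_I_finite)
    also have "\<dots> = (\<Prod>l\<in>K. emeasure lborel (?B l))"
      using K(1) B by (rule lborel_product.emeasure_PiM)
    also have "\<dots> = (\<Prod>i\<in>I. emeasure lborel (A i))"
      unfolding K(2)[symmetric] using K(3) by (simp add: prod.reindex)
    finally show "emeasure (distr (LP K) (LP I) (\<lambda>x. \<lambda>i\<in>I. x (h i))) (Pi\<^sub>E I A) = (\<Prod>i\<in>I. emeasure lborel (A i))" .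
  qed (use assms in auto)
  then show ?thesis using nn_integral_distr[OF m, of f] f by simp
qed

lemma nn_integral_PiM_scale:
  assumes "finite I" "\<And>i. i \<in> I \<Longrightarrow> d i \<noteq> 0" "f \<in> borel_measurable (LP I)"
  shows "(\<Prod>i\<in>I. ennreal \<bar>d i\<bar>) * (\<integral>\<^sup>+x. f (\<lambda>i\<in>I. d i * x i) \<partial>LP I) = (\<integral>\<^sup>+x. f x \<partial>LP I)"
  using assms
proof (induction I arbitrary: f rule: finite_induct)
  case empty
  have "restrict u {} = x" if "x \<in> space (LP {})" for u x :: "'a \<Rightarrow> real"
    using that by (auto simp: space_PiM)
  then have "(\<integral>\<^sup>+x. f (\<lambda>i\<in>{}. d i * x i) \<partial>LP {}) = (\<integral>\<^sup>+x. f x \<partial>LP {})"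
    by (intro nn_integral_cong arg_cong[where f=f])
  then show ?case by (simp only: prod.empty mult_1_left)
next
  case (insert i I)
  note [measurable] = insert.prems(2)
  note [simp] = insert.hyps
  have ud: "(\<lambda>(x, y). x(i := y)) \<in> LP I \<Otimes>\<^sub>M lborel \<rightarrow>\<^sub>M LP (insert i I)"
    by (rule measurable_add_dim)
  have m2: "(\<lambda>(x, y). f (x(i := d i * y))) \<in> borel_measurable (LP I \<Otimes>\<^sub>M lborel)"
  proof -
    have "(\<lambda>z. (fst z, d i * snd z)) \<in> LP I \<Otimes>\<^sub>M lborel \<rightarrow>\<^sub>M LP I \<Otimes>\<^sub>M lborel" by measurable
    from measurable_compose[OF measurable_compose[OF this ud], of f] show ?thesis
      by (simp add: case_prod_beta')
  qed
  have m3: "(\<lambda>x. \<integral>\<^sup>+y. f (x(i := d i * y)) \<partial>lborel) \<in> borel_measurable (LP I)"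
    using lborel.borel_measurable_nn_integral[of "\<lambda>x y. f (x(i := d i * y))" "LP I"] m2 by simp
  have aff: "(\<integral>\<^sup>+y. f (x(i := y)) \<partial>lborel) = ennreal \<bar>d i\<bar> * (\<integral>\<^sup>+y. f (x(i := d i * y)) \<partial>lborel)"
    if "x \<in> space (LP I)" for x
  proof -
    have "(\<lambda>y. f (x(i := y))) \<in> borel_measurable lborel"
      using measurable_comp[OF measurable_component_update[of x I] insert.prems(2)] that
      by (simp add: comp_def)
    then show ?thesis using nn_integral_real_affine[of "\<lambda>y. f (x(i := y))" "d i" 0] insert.prems(1)[of i] by simp
  qed
  have r: "(\<lambda>j\<in>insert i I. d j * (x(i := y)) j) = (\<lambda>j\<in>I. d j * x j)(i := d i * y)" for x y
    using insert.hyps by (auto simp: fun_eq_iff)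
  have mr: "(\<lambda>x. \<lambda>j\<in>insert i I. d j * x j) \<in> LP (insert i I) \<rightarrow>\<^sub>M LP (insert i I)"
    by (intro measurable_restrict) measurable
  have "(\<integral>\<^sup>+x. f x \<partial>LP (insert i I)) = (\<integral>\<^sup>+x. \<integral>\<^sup>+y. f (x(i := y)) \<partial>lborel \<partial>LP I)"
    by (rule lborel_product.product_nn_integral_insert) simp_all
  also have "\<dots> = (\<integral>\<^sup>+x. ennreal \<bar>d i\<bar> * (\<integral>\<^sup>+y. f (x(i := d i * y)) \<partial>lborel) \<partial>LP I)"
    by (intro nn_integral_cong aff)
  also have "\<dots> = ennreal \<bar>d i\<bar> * (\<integral>\<^sup>+x. \<integral>\<^sup>+y. f (x(i := d i * y)) \<partial>lborel \<partial>LP I)"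
    by (rule nn_integral_cmult[OF m3])
  also have "(\<integral>\<^sup>+x. \<integral>\<^sup>+y. f (x(i := d i * y)) \<partial>lborel \<partial>LP I) =
     (\<Prod>i\<in>I. ennreal \<bar>d i\<bar>) * (\<integral>\<^sup>+x. \<integral>\<^sup>+y. f ((\<lambda>j\<in>I. d j * x j)(i := d i * y)) \<partial>lborel \<partial>LP I)"
    by (rule insert.IH[OF _ m3, symmetric]) (use insert.prems(1) in auto)
  also have "(\<integral>\<^sup>+x. \<integral>\<^sup>+y. f ((\<lambda>j\<in>I. d j * x j)(i := d i * y)) \<partial>lborel \<partial>LP I) =
      (\<integral>\<^sup>+x. \<integral>\<^sup>+y. f (\<lambda>j\<in>insert i I. d j * (x(i := y)) j) \<partial>lborel \<partial>LP I)"
    by (simp only: r)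
  also have "\<dots> = (\<integral>\<^sup>+x. f (\<lambda>j\<in>insert i I. d j * x j) \<partial>LP (insert i I))"
    using measurable_compose[OF mr insert.prems(2)]
    by (intro lborel_product.product_nn_integral_insert[symmetric]) simp_all
  finally show ?case by (simp only: prod.insert[OF insert.hyps] mult.assoc)
qed

text \<open>With the other coordinates fixed, a shear is a translation of coordinate
  \<open>m\<close>, so one-dimensional translation invariance under Fubini suffices.\<close>

lemma nn_integral_PiM_shear:
  fixes f :: "('k \<Rightarrow> real) \<Rightarrow> ennreal"
  assumes "finite I" "m \<in> I" "n \<in> I" "m \<noteq> n" and f: "f \<in> borel_measurable (LP I)"
  shows "(\<integral>\<^sup>+x. f (x(m := x m + c * x n)) \<partial>LP I) = (\<integral>\<^sup>+x. f x \<partial>LP I)"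
proof -
  define K where "K = I - {m}"
  have K: "insert m K = I" "m \<notin> K" "finite K" "n \<in> K" using assms by (auto simp: K_def)
  have aff: "(\<integral>\<^sup>+y. f (x(m := y)) \<partial>lborel) = (\<integral>\<^sup>+y. f (x(m := y + c * x n)) \<partial>lborel)"
    if "x \<in> space (LP K)" for x
  proof -
    have "(\<lambda>y. f (x(m := y))) \<in> borel_measurable lborel"
      using measurable_compose[OF measurable_component_update f[folded K(1)], OF that K(2)] by (simp only: measurable_lborel1 measurable_lborel2)
    then show ?thesis using nn_integral_real_affine[of "\<lambda>y. f (x(m := y))" 1 "c * x n"]
      by (simp add: add.commute)
  qed
  have "(\<lambda>x. x(m := x m + c * x n)) \<in> LP I \<rightarrow>\<^sub>M LP I"
    by (rule measurable_fun_upd[where J=I])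
      (use assms(2,3) in \<open>auto intro!: borel_measurable_add borel_measurable_times measurable_component_singleton\<close>)
  from measurable_compose[OF this f]
  have g: "(\<lambda>x. f (x(m := x m + c * x n))) \<in> borel_measurable (LP (insert m K))" using K by simp
  have "(\<integral>\<^sup>+x. f x \<partial>LP (insert m K)) = (\<integral>\<^sup>+x. \<integral>\<^sup>+y. f (x(m := y)) \<partial>lborel \<partial>LP K)"
    using K f by (intro lborel_product.product_nn_integral_insert) simp_all
  also have "\<dots> = (\<integral>\<^sup>+x. \<integral>\<^sup>+y. f (x(m := y + c * x n)) \<partial>lborel \<partial>LP K)"
    by (intro nn_integral_cong aff)
  also have "\<dots> = (\<integral>\<^sup>+x. f (x(m := x m + c * x n)) \<partial>LP (insert m K))"
    using assms(4) by (subst lborel_product.product_nn_integral_insert[OF K(3,2) g]) simp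
  finally show ?thesis using K by simp
qed

lemma nn_integral_matrix_UNIV:
  fixes A :: "real^'k^'k"
  assumes "det A \<noteq> 0" "f \<in> borel_measurable (LP UNIV)"
  shows "ennreal \<bar>det A\<bar> * (\<integral>\<^sup>+x. f (\<lambda>i. \<Sum>j\<in>UNIV. A$i$j * x j) \<partial>LP UNIV) = (\<integral>\<^sup>+x. f x \<partial>LP UNIV)"
proof -
  have meas: "(\<lambda>x. \<lambda>i. \<Sum>j\<in>UNIV. A$i$j * x j) \<in> LP UNIV \<rightarrow>\<^sub>M LP UNIV" for A :: "real^'k^'k"
    using measurable_restrict[of UNIV "\<lambda>i x. \<Sum>j\<in>UNIV. A$i$j * x j" "LP UNIV" "\<lambda>_. lborel"]
    by (simp add: restrict_def)
  \<comment> \<open>The disjunct \<open>det A = 0\<close> is there because the induction runs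
    through all matrices, including those with a zero row. The function \<open>f\<close> is
    quantified inside \<open>P\<close> because the product case applies \<open>P B\<close> to
    \<open>f\<close> composed with the action of \<open>A\<close>.\<close>
  define P where "P A \<longleftrightarrow> det A = 0 \<or> (\<forall>f\<in>borel_measurable (LP UNIV).
     ennreal \<bar>det A\<bar> * (\<integral>\<^sup>+x. f (\<lambda>i. \<Sum>j\<in>UNIV. A$i$j * x j) \<partial>LP UNIV) = (\<integral>\<^sup>+x. f x \<partial>LP UNIV))" for A :: "real^'k^'k"
  have "P A"
  proof (rule induct_matrix_elementary)
    fix A B :: "real^'k^'k" assume AB: "P A" "P B"
    show "P (A ** B)"
    proof (cases "det A = 0 \<or> det B = 0")
      case True then show ?thesis by (auto simp: P_def det_mul)
    next
      case False
      { fix f :: "('k \<Rightarrow> real) \<Rightarrow> ennreal" assume f: "f \<in> borel_measurable (LP UNIV)"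
        have e: "(\<lambda>i. \<Sum>j\<in>UNIV. (A ** B)$i$j * x j) = (\<lambda>i. \<Sum>j\<in>UNIV. A$i$j * (\<Sum>k\<in>UNIV. B$j$k * x k))" for x
        proof
          fix i
          have "(\<Sum>j\<in>UNIV. (A ** B)$i$j * x j) = (\<Sum>j\<in>UNIV. \<Sum>k\<in>UNIV. A$i$k * (B$k$j * x j))"
            by (simp add: matrix_matrix_mult_def sum_distrib_right mult.assoc)
          also have "\<dots> = (\<Sum>k\<in>UNIV. \<Sum>j\<in>UNIV. A$i$k * (B$k$j * x j))"
            by (rule sum.swap)
          finally show "(\<Sum>j\<in>UNIV. (A ** B)$i$j * x j) = (\<Sum>j\<in>UNIV. A$i$j * (\<Sum>k\<in>UNIV. B$j$k * x k))"
            by (simp add: sum_distrib_left)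
        qed
        have g: "(\<lambda>x. f (\<lambda>i. \<Sum>j\<in>UNIV. A$i$j * x j)) \<in> borel_measurable (LP UNIV)"
          using measurable_compose[OF meas f] .
        have "(\<integral>\<^sup>+x. f x \<partial>LP UNIV) = ennreal \<bar>det A\<bar> * (\<integral>\<^sup>+x. f (\<lambda>i. \<Sum>j\<in>UNIV. A$i$j * x j) \<partial>LP UNIV)"
          using AB False f by (auto simp: P_def)
        also have "(\<integral>\<^sup>+x. f (\<lambda>i. \<Sum>j\<in>UNIV. A$i$j * x j) \<partial>LP UNIV) =
            ennreal \<bar>det B\<bar> * (\<integral>\<^sup>+x. f (\<lambda>i. \<Sum>j\<in>UNIV. (A ** B)$i$j * x j) \<partial>LP UNIV)"
          using AB(2) False g by (auto simp: P_def e)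
        finally have "ennreal \<bar>det (A ** B)\<bar> * (\<integral>\<^sup>+x. f (\<lambda>i. \<Sum>j\<in>UNIV. (A ** B)$i$j * x j) \<partial>LP UNIV) = (\<integral>\<^sup>+x. f x \<partial>LP UNIV)"
          by (simp add: det_mul abs_mult ennreal_mult mult.assoc) }
      then show ?thesis by (auto simp: P_def)
    qed
  next
    fix A :: "real^'k^'k" and i assume "row i A = 0"
    then show "P A" by (simp add: P_def det_zero_row)
  next
    fix A :: "real^'k^'k" assume A: "\<And>i j. i \<noteq> j \<Longrightarrow> A$i$j = 0"
    have d: "det A = (\<Prod>i\<in>UNIV. A$i$i)" using A by (rule det_diagonal)
    have e: "(\<lambda>i. \<Sum>j\<in>UNIV. A$i$j * x j) = (\<lambda>i. A$i$i * x i)" for x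
    proof
      fix i
      have "(\<Sum>j\<in>UNIV. A$i$j * x j) = (\<Sum>j\<in>{i}. A$i$j * x j)"
        by (rule sum.mono_neutral_right) (use A in auto)
      then show "(\<Sum>j\<in>UNIV. A$i$j * x j) = A$i$i * x i" by simp
    qed
    show "P A"
      using nn_integral_PiM_scale[of UNIV "\<lambda>i. A$i$i"]
      by (auto simp: P_def e d abs_prod prod_ennreal restrict_def)
  next
    fix m n :: 'k assume "m \<noteq> n"
    let ?S = "(\<chi> i j. mat 1 $ i $ Transposition.transpose m n j) :: real^'k^'k"
    let ?t = "Transposition.transpose m n"
    have e: "(\<lambda>i. \<Sum>j\<in>UNIV. ?S$i$j * x j) = (\<lambda>i. x (?t i))" for x :: "'k \<Rightarrow> real"
    proof
      fix i
      have "(\<Sum>j\<in>UNIV. ?S$i$j * x j) = (\<Sum>j\<in>UNIV. if j = ?t i then x j else 0)"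
        by (intro sum.cong) (auto simp: mat_def)
      then show "(\<Sum>j\<in>UNIV. ?S$i$j * x j) = x (?t i)" by simp
    qed
    have "\<bar>det ?S\<bar> = 1"
      using det_permute_columns[of ?t "mat 1 :: real^'k^'k"] \<open>m \<noteq> n\<close> by (simp add: permutes_swap_id sign_swap_id)
    then show "P ?S"
      using nn_integral_PiM_reindex[of UNIV ?t UNIV] unfolding P_def e by (auto simp: restrict_def)
  next
    fix m n :: 'k and c :: real assume mn: "m \<noteq> n"
    let ?S = "(\<chi> i j. if i = m \<and> j = n then c else of_bool (i = j)) :: real^'k^'k"
    have e: "(\<lambda>i. \<Sum>j\<in>UNIV. ?S$i$j * x j) = x(m := x m + c * x n)" for x :: "'k \<Rightarrow> real"
    proof
      fix i
      have "(\<Sum>j\<in>UNIV. ?S$i$j * x j) = (\<Sum>j\<in>UNIV. (if j = n then if i = m then c * x j else 0 else 0) + (if j = i then x j else 0))"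
        by (intro sum.cong) (use mn in auto)
      then show "(\<Sum>j\<in>UNIV. ?S$i$j * x j) = (x(m := x m + c * x n)) i" by (auto simp: sum.distrib)
    qed
    have "?S = (\<chi> k. if k = m then row m (mat 1) + c *s row n (mat 1) else row k (mat 1))"
      using mn by (auto simp: vec_eq_iff row_def mat_def)
    then have "det ?S = 1" using det_row_operation[OF mn, of "mat 1 :: real^'k^'k" c] by simp
    then show "P ?S"
      using nn_integral_PiM_shear[of UNIV m n, OF _ _ _ mn] unfolding P_def e by auto
  qed
  then show ?thesis using assms by (auto simp: P_def)
qed

text \<open>The unit interval has length 1, so indicators on the coordinates outside
  \<open>J\<close> integrate to 1. This moves an integral over \<open>J\<close> to all coordinates,
  where a square matrix can act.\<close>

lemma nn_integral_PiM_pad: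
  fixes G :: "('k::finite \<Rightarrow> real) \<Rightarrow> ennreal"
  assumes [measurable]: "G \<in> borel_measurable (LP J)"
  shows "(\<integral>\<^sup>+x. G (restrict x J) * (\<Prod>i\<in>-J. indicator {0..1} (x i)) \<partial>LP UNIV) = (\<integral>\<^sup>+x. G x \<partial>LP J)"
proof -
  have [measurable]: "(\<lambda>x. restrict x J) \<in> LP UNIV \<rightarrow>\<^sub>M LP J"
    by (rule measurable_restrict_subset) simp
  have [measurable]: "(\<lambda>x. \<Prod>i\<in>-J. indicator {0..1} (x i) :: ennreal) \<in> borel_measurable (LP K)" if "-J \<subseteq> K" for K
    using that by (intro borel_measurable_prod_ennreal measurable_compose[OF measurable_component_singleton]) auto
  have m: "(\<lambda>x. G (restrict x J) * (\<Prod>i\<in>-J. indicator {0..1} (x i))) \<in> borel_measurable (LP (J \<union> -J))"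
    unfolding Compl_partition by measurable
  have e: "G (restrict (merge J (-J) (x, y)) J) * (\<Prod>i\<in>-J. indicator {0..1} (merge J (-J) (x, y) i)) =
      G x * (\<Prod>i\<in>-J. indicator {0..1} (y i))" if "x \<in> space (LP J)" for x y
  proof -
    have "restrict (merge J (-J) (x, y)) J = x"
      using that by (auto simp: merge_def space_PiM PiE_iff extensional_def fun_eq_iff)
    then show ?thesis by (simp add: merge_def)
  qed
  have "(\<integral>\<^sup>+x. G (restrict x J) * (\<Prod>i\<in>-J. indicator {0..1} (x i)) \<partial>LP (J \<union> -J)) =
     (\<integral>\<^sup>+x. \<integral>\<^sup>+y. G x * (\<Prod>i\<in>-J. indicator {0..1} (y i)) \<partial>LP (-J) \<partial>LP J)"
    by (subst lborel_product.product_nn_integral_fold[OF _ _ _ m], simp, simp, simp)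
      (intro nn_integral_cong e)
  also have "\<dots> = (\<integral>\<^sup>+x. G x * (\<integral>\<^sup>+y. (\<Prod>i\<in>-J. indicator {0..1} (y i)) \<partial>LP (-J)) \<partial>LP J)"
    by (intro nn_integral_cong nn_integral_cmult) measurable
  also have "(\<integral>\<^sup>+y. (\<Prod>i\<in>-J. indicator {0..1} (y i)) \<partial>LP (-J)) = 1"
    by (subst lborel_product.product_nn_integral_prod) auto
  finally show ?thesis by (simp only: mult_1_right Un_UNIV_right Compl_partition)
qed

text \<open>The two conditions \<open>id\<close> and \<open>loc\<close> say that \<open>F\<close> is
  block diagonal with an identity block off \<open>J\<close>. Its full determinant is therefore the
  Jacobian of the part on \<open>J\<close>, and the padding indicators are left fixed by
  \<open>F\<close>.\<close>

lemma nn_integral_PiM_linear: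
  fixes F :: "real^'k \<Rightarrow> real^'k"
  assumes lin: "linear F" and det: "det (matrix F) \<noteq> 0"
    and id: "\<And>x i. i \<notin> J \<Longrightarrow> F x $ i = x $ i"
    and loc: "\<And>x y i. i \<in> J \<Longrightarrow> (\<And>j. j \<in> J \<Longrightarrow> x$j = y$j) \<Longrightarrow> F x $ i = F y $ i"
    and G[measurable]: "G \<in> borel_measurable (LP J)"
  shows "ennreal \<bar>det (matrix F)\<bar> * (\<integral>\<^sup>+x. G (\<lambda>i\<in>J. F (\<chi> j. x j) $ i) \<partial>LP J) = (\<integral>\<^sup>+x. G x \<partial>LP J)"
proof -
  let ?I = "\<lambda>x. (\<Prod>i\<in>-J. indicator {0..1} (x i :: real)) :: ennreal"
  have [measurable]: "(\<lambda>x. restrict x J) \<in> LP UNIV \<rightarrow>\<^sub>M LP J"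
    by (rule measurable_restrict_subset) simp
  have Fx: "F (\<chi> j. x j) $ i = (\<Sum>j\<in>UNIV. matrix F $ i $ j * x j)" for x i
  proof -
    have "F (\<chi> j. x j) = matrix F *v (\<chi> j. x j)" by (simp add: lin matrix_works)
    then show ?thesis by (simp add: matrix_vector_mult_def)
  qed
  have mF: "(\<lambda>x. \<lambda>i\<in>J. F (\<chi> j. x j) $ i) \<in> LP J \<rightarrow>\<^sub>M LP J"
  proof (rule measurable_restrict)
    fix i assume i: "i \<in> J"
    \<comment> \<open>Coordinates outside \<open>J\<close> are not among those of
      \<open>LP J\<close>; by \<open>loc\<close> they may be replaced by 0, which leaves a finite
      sum of measurable terms.\<close>
    have "F (\<chi> j. x j) $ i = (\<Sum>j\<in>UNIV. matrix F $ i $ j * (if j \<in> J then x j else 0))" for x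
      using loc[OF i, of "\<chi> j. x j" "\<chi> j. if j \<in> J then x j else 0"] Fx[of "\<lambda>j. if j \<in> J then x j else 0" i] by simp
    moreover have "(\<lambda>x. if j \<in> J then x j else 0) \<in> borel_measurable (LP J)" for j
      by (cases "j \<in> J") auto
    ultimately show "(\<lambda>x. F (\<chi> j. x j) $ i) \<in> LP J \<rightarrow>\<^sub>M lborel" by simp
  qed
  have [measurable]: "(\<lambda>x. G (\<lambda>i\<in>J. F (\<chi> j. x j) $ i)) \<in> borel_measurable (LP J)"
    using measurable_compose[OF mF G] .
  have r: "restrict (\<lambda>i. F (\<chi> j. x j) $ i) J = (\<lambda>i\<in>J. F (\<chi> j. restrict x J j) $ i)" for x
    by (auto simp: fun_eq_iff intro!: loc)
  have "(\<integral>\<^sup>+x. G x \<partial>LP J) = (\<integral>\<^sup>+x. G (restrict x J) * ?I x \<partial>LP UNIV)"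
    by (rule nn_integral_PiM_pad[symmetric]) fact
  also have "\<dots> = ennreal \<bar>det (matrix F)\<bar> * (\<integral>\<^sup>+x. G (restrict (\<lambda>i. F (\<chi> j. x j) $ i) J) * ?I (\<lambda>i. F (\<chi> j. x j) $ i) \<partial>LP UNIV)"
    unfolding Fx by (rule nn_integral_matrix_UNIV[OF det, symmetric]) measurable
  also have "(\<integral>\<^sup>+x. G (restrict (\<lambda>i. F (\<chi> j. x j) $ i) J) * ?I (\<lambda>i. F (\<chi> j. x j) $ i) \<partial>LP UNIV) =
     (\<integral>\<^sup>+x. G (\<lambda>i\<in>J. F (\<chi> j. restrict x J j) $ i) * ?I x \<partial>LP UNIV)"
    by (intro nn_integral_cong arg_cong2[where f="(*)"] arg_cong[where f=G] prod.cong r) (simp_all add: id)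
  also have "\<dots> = (\<integral>\<^sup>+x. G (\<lambda>i\<in>J. F (\<chi> j. x j) $ i) \<partial>LP J)"
    by (rule nn_integral_PiM_pad) measurable
  finally show ?thesis by simp
qed

section \<open>Positive definite matrices\<close>

lemma matrix_diff_ldistrib: "A ** (B - C) = A ** B - A ** (C :: real^'n^'m)"
  by (simp add: matrix_matrix_mult_def vec_eq_iff algebra_simps sum_subtractf)

lemma matrix_diff_rdistrib: "(A - B) ** C = A ** C - (B :: real^'n^'m) ** C"
  by (simp add: matrix_matrix_mult_def vec_eq_iff algebra_simps sum_subtractf)

lemma symmetric_inner: "transpose A = A \<Longrightarrow> x \<bullet> (A *v y) = (A *v x) \<bullet> (y :: real^'n)"
  using dot_lmul_matrix[of x A y] by (simp flip: transpose_matrix_vector)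

lemma transpose_eqI:
  fixes A :: "real^'n^'n"
  assumes "\<And>x y. x \<bullet> (A *v y) = (A *v x) \<bullet> y"
  shows "transpose A = A"
proof -
  have "x v* A = A *v x" for x
    by (rule vector_eq_rdot[THEN iffD1]) (simp only: dot_lmul_matrix assms simp_thms)
  then show ?thesis by (simp add: matrix_eq)
qed

definition psd :: "real^'n^'n \<Rightarrow> bool" where
  "psd A \<longleftrightarrow> transpose A = A \<and> (\<forall>x. 0 \<le> x \<bullet> (A *v x))"

lemma pos_def_imp_psd: "pos_def A \<Longrightarrow> psd A"
  by (metis inner_zero_left less_imp_le order_refl pos_def_def psd_def)

text \<open>\<open>T\<close> may be singular. This matters for the choices \<open>T\<close> =
  \<open>A - mat 1\<close> and \<open>T\<close> = a difference of two square roots.\<close>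

lemma psd_congruence:
  assumes "psd A"
  shows "psd (transpose T ** A ** T)"
proof -
  have sym: "transpose A = A" and nonneg: "\<And>x. 0 \<le> x \<bullet> (A *v x)" using assms by (auto simp: psd_def)
  have "x \<bullet> ((transpose T ** A ** T) *v x) = (T *v x) \<bullet> (A *v (T *v x))" for x
    using dot_lmul_matrix[of x "transpose T" "A *v (T *v x)"]
    by (simp add: matrix_vector_mul_assoc[symmetric] del: transpose_matrix_vector)
  moreover have "transpose (transpose T ** A ** T) = transpose T ** A ** T"
    by (simp only: matrix_transpose_mul transpose_transpose sym matrix_mul_assoc)
  ultimately show ?thesis using nonneg by (simp add: psd_def)
qed

lemma inner_axis_matrix_axis: "axis i 1 \<bullet> (A *v axis j (1::real)) = A$i$j"
  by (simp add: inner_axis' matrix_vector_mult_basis column_def)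

lemma trace_eq_sum_inner: "trace A = (\<Sum>i\<in>UNIV. axis i 1 \<bullet> (A *v axis i (1::real)))"
  by (simp add: trace_def inner_axis_matrix_axis)

lemma trace_psd_nonneg: "psd A \<Longrightarrow> 0 \<le> trace A"
  by (simp add: trace_eq_sum_inner psd_def sum_nonneg)

text \<open>The form at e_i + e_j and at e_i - e_j bounds 2 |A_ij| by A_ii + A_jj, and each diagonal
  entry is nonnegative, hence at most the trace.\<close>

lemma psd_abs_entry_le_trace:
  fixes A :: "real^'n^'n"
  assumes "psd A"
  shows "\<bar>A$i$j\<bar> \<le> trace A"
proof -
  have s: "A$j$i = A$i$j" 
  proof -
    have "transpose A $ i $ j = A $ i $ j" using assms by (simp add: psd_def)
    then show ?thesis by (simp add: transpose_def)
  qed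
  have d: "0 \<le> A$k$k" for k using assms inner_axis_matrix_axis[of k A k] unfolding psd_def by metis
  have "0 \<le> (axis i 1 + axis j 1) \<bullet> (A *v (axis i 1 + axis j 1))"
       "0 \<le> (axis i 1 - axis j 1) \<bullet> (A *v (axis i 1 - axis j 1))"
    using assms by (auto simp: psd_def)
  then have b: "2 * \<bar>A$i$j\<bar> \<le> A$i$i + A$j$j"
    by (simp add: algebra_simps inner_axis_matrix_axis s)
  have "A$k$k \<le> trace A" for k
    unfolding trace_def by (rule member_le_sum) (auto simp: d)
  from this[of i] this[of j] b show ?thesis by simp
qed

lemma abs_det_le:
  fixes A :: "real^'n^'n"
  assumes "\<And>i j. \<bar>A$i$j\<bar> \<le> K"
  shows "\<bar>det A\<bar> \<le> fact CARD('n) * K ^ CARD('n)"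
proof -
  have "\<bar>det A\<bar> \<le> (\<Sum>p | p permutes (UNIV::'n set). \<bar>of_int (sign p) * (\<Prod>i\<in>UNIV. A$i$p i)\<bar>)"
    unfolding det_def by (rule sum_abs)
  also have "\<dots> \<le> (\<Sum>p | p permutes (UNIV::'n set). K ^ CARD('n))"
  proof (rule sum_mono)
    fix p :: "'n \<Rightarrow> 'n"
    have "\<bar>of_int (sign p) * (\<Prod>i\<in>UNIV. A$i$p i)\<bar> = (\<Prod>i\<in>UNIV. \<bar>A$i$p i\<bar>)"
      by (simp add: abs_mult abs_prod sign_def)
    also have "\<dots> \<le> (\<Prod>i\<in>(UNIV::'n set). K)"
      by (rule prod_mono) (use assms in auto)
    finally show "\<bar>of_int (sign p) * (\<Prod>i\<in>UNIV. A$i$p i)\<bar> \<le> K ^ CARD('n)" by simp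
  qed
  finally show ?thesis by (simp add: card_permutations)
qed

text \<open>The trace is the sum of the values of the form of \<open>A\<close> at the columns of
  \<open>D\<close>. All summands are nonnegative, so each vanishes, and definiteness kills each
  column.\<close>

lemma psd_trace_product_zero:
  assumes "psd A" "transpose D = D" "\<And>x. x \<bullet> (A *v x) = 0 \<Longrightarrow> x = 0" "trace (D ** A ** D) = 0"
  shows "D = (0 :: real^'n^'n)"
proof -
  have e: "axis i 1 \<bullet> ((D ** A ** D) *v axis i 1) = (D *v axis i 1) \<bullet> (A *v (D *v axis i 1))" for i
    using assms(2) by (simp add: symmetric_inner flip: matrix_vector_mul_assoc)
  have "(\<Sum>i\<in>UNIV. (D *v axis i 1) \<bullet> (A *v (D *v axis i 1))) = 0"
    using assms(4) by (simp add: trace_eq_sum_inner e)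
  then have "(D *v axis i 1) \<bullet> (A *v (D *v axis i 1)) = 0" for i
    using assms(1) by (subst (asm) sum_nonneg_eq_0_iff) (auto simp: psd_def)
  then have "D *v axis i 1 = 0" for i using assms(3) by blast
  then show ?thesis by (simp add: matrix_vector_mult_basis column_def vec_eq_iff)
qed

section \<open>Square roots of positive definite matrices\<close>

lemma pos_def_eq_0: "pos_def A \<Longrightarrow> x \<bullet> (A *v x) = 0 \<Longrightarrow> x = 0"
  unfolding pos_def_def by fastforce

text \<open>The difference D = S - T satisfies D S + T D = S^2 - T^2 = 0. Multiplying by D on the
  left and taking traces gives tr (D S D) + tr (D T D) = 0 with both terms nonnegative.\<close>

lemma pos_def_sqrt_unique:
  assumes S: "pos_def S" and T: "pos_def T" and eq: "S ** S = T ** T"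
  shows "S = T"
proof -
  define D where "D = S - T"
  have tr: "transpose S = S" "transpose T = T" using S T by (auto simp: pos_def_def)
  then have D: "transpose D = D" by (simp add: D_def transpose_def vec_eq_iff)
  have "D ** S + T ** D = 0"
    by (simp add: D_def matrix_diff_ldistrib matrix_diff_rdistrib eq)
  then have "D ** (D ** S + T ** D) = 0" by (simp add: matrix_eq flip: matrix_vector_mul_assoc)
  then have "trace (D ** D ** S) + trace (D ** T ** D) = 0"
    by (simp add: matrix_add_ldistrib matrix_mul_assoc flip: trace_add) (simp add: trace_def)
  moreover have "trace (D ** D ** S) = trace (D ** S ** D)"
    by (metis matrix_mul_assoc trace_mul_sym)
  moreover have "0 \<le> trace (D ** A ** D)" if "pos_def A" for A
    using trace_psd_nonneg[OF psd_congruence[OF pos_def_imp_psd[OF that], of D]] by (simp add: D)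
  ultimately have "trace (D ** S ** D) = 0" using S T by (metis add_nonneg_eq_0_iff)
  then have "D = 0" using psd_trace_product_zero[OF pos_def_imp_psd[OF S] D] pos_def_eq_0[OF S] by blast
  then show ?thesis by (simp add: D_def)
qed

text \<open>The lower constant is the minimum of the form on the compact unit sphere, the upper one
  an operator norm bound. Together they give the contraction rate of the square root iteration; the
  lower one also gives measurability of \<open>pos_def\<close>.\<close>

lemma pos_def_bounds:
  fixes A :: "real^'n::{finite,linorder}^'n::{finite,linorder}"
  assumes "pos_def A"
  obtains c d where "0 < c" "0 < d" "\<And>x. d * (x \<bullet> x) \<le> x \<bullet> (A *v x)" "\<And>x. x \<bullet> (A *v x) \<le> c * (x \<bullet> x)"
proof -
  obtain K where K: "0 < K" "\<And>x. norm (A *v x) \<le> norm x * K"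
    using bounded_linear.pos_bounded[OF matrix_vector_mul_bounded_linear[of A]] by blast
  have up: "x \<bullet> (A *v x) \<le> K * (x \<bullet> x)" for x
  proof -
    have "x \<bullet> (A *v x) \<le> norm x * norm (A *v x)" by (rule norm_cauchy_schwarz)
    also have "\<dots> \<le> norm x * (norm x * K)" by (intro mult_left_mono K) auto
    finally show ?thesis by (simp add: power2_norm_eq_inner[symmetric] power2_eq_square mult_ac)
  qed
  obtain u :: "real^'n::_" where u: "norm u = 1" "\<And>x. norm x = 1 \<Longrightarrow> u \<bullet> (A *v u) \<le> x \<bullet> (A *v x)"
  proof -
    have "continuous_on (sphere 0 1) (\<lambda>x. x \<bullet> (A *v x))"
      by (intro continuous_intros linear_continuous_on matrix_vector_mul_bounded_linear)
    from continuous_attains_inf[OF compact_sphere _ this] show thesis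
      using that by (auto simp: sphere_eq_empty)
  qed
  have lo: "(u \<bullet> (A *v u)) * (x \<bullet> x) \<le> x \<bullet> (A *v x)" for x
  proof (cases "x = 0")
    case False
    have "u \<bullet> (A *v u) \<le> ((1 / norm x) *\<^sub>R x) \<bullet> (A *v ((1 / norm x) *\<^sub>R x))"
      using False by (intro u(2)) simp
    then show ?thesis using False
      by (simp add: matrix_vector_mult_scaleR field_simps power2_norm_eq_inner[symmetric] power2_eq_square)
  qed simp
  have "u \<noteq> 0" using u(1) by auto
  then have "0 < u \<bullet> (A *v u)" using assms by (auto simp: pos_def_def)
  with K(1) lo up show ?thesis by (rule_tac that) blast+
qed

text \<open>Write A = c (1 - B), so that B is self-adjoint of norm at most r = 1 - d/c < 1. A fixed
  point Y of Y -> (B + Y^2) / 2 satisfies (1 - Y)^2 = 1 - B, hence sqrt c (1 - Y) is a square root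
  of A, and it is positive since Y has norm at most r < 1.\<close>

lemma pos_def_sqrt_exists:
  fixes A :: "real^'n::{finite,linorder}^'n::{finite,linorder}"
  assumes A: "pos_def A"
  shows "\<exists>S. pos_def S \<and> S ** S = A"
proof -
  obtain c d where cd: "0 < c" "0 < d" "\<And>x. d * (x \<bullet> x) \<le> x \<bullet> (A *v x)" "\<And>x. x \<bullet> (A *v x) \<le> c * (x \<bullet> x)"
    using pos_def_bounds[OF A] by blast
  have symA: "x \<bullet> (A *v y) = (A *v x) \<bullet> y" for x y using A by (simp add: pos_def_def symmetric_inner)
  define r where "r = 1 - d / c"
  define B where "B = (\<lambda>x::real^'n::_. x - (1 / c) *\<^sub>R (A *v x))"
  have blB: "bounded_linear B"
    unfolding B_def by (intro bounded_linear_sub bounded_linear_ident bounded_linear_compose[OF bounded_linear_scaleR_right] matrix_vector_mul_bounded_linear)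
  have Bsym: "x \<bullet> B y = B x \<bullet> y" for x y by (simp add: B_def inner_diff_left inner_diff_right symA)
  have Blo: "0 \<le> x \<bullet> B x" for x
    using cd(1) cd(4)[of x] by (simp add: B_def inner_diff_right field_simps)
  have Bup: "x \<bullet> B x \<le> r * (x \<bullet> x)" for x
    using cd(1) cd(3)[of x] by (simp add: B_def r_def inner_diff_right field_simps)
  have "r < 1" using cd by (simp add: r_def)
  have "0 \<le> r"
  proof -
    have "0 \<le> r * (axis undefined 1 \<bullet> (axis undefined 1 :: real^'n::_))" using Blo Bup order_trans by blast
    then show ?thesis by (simp add: inner_axis)
  qed
  define b where "b = Blinfun B"
  have b: "blinfun_apply b = B" by (simp add: b_def bounded_linear_Blinfun_apply blB)
  have nb: "norm b \<le> r"
  proof (rule norm_blinfun_bound[OF \<open>0 \<le> r\<close>], unfold b)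
    fix x
    show "norm (B x) \<le> r * norm x"
    proof (cases "x = 0 \<or> B x = 0")
      case False
      define v where "v = (1 / norm x) *\<^sub>R x"
      define w where "w = (1 / norm (B x)) *\<^sub>R B x"
      have n1: "v \<bullet> v = 1" "w \<bullet> w = 1" using False
        by (auto simp: v_def w_def power2_norm_eq_inner[symmetric] power2_eq_square)
      have Badd: "B (x + y) = B x + B y" "B (x - y) = B x - B y" for x y
        using blB by (simp_all add: linear_simps)
      \<comment> \<open>Polarisation turns the two-sided bound on the quadratic form of the
        self-adjoint \<open>B\<close> into a bound on its operator norm.\<close>
      have "4 * (w \<bullet> B v) = (v + w) \<bullet> B (v + w) - (v - w) \<bullet> B (v - w)"
        using Bsym[of v w] Bsym[of w v] by (simp add: Badd algebra_simps inner_commute)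
      also have "\<dots> \<le> r * ((v + w) \<bullet> (v + w))" using Blo[of "v - w"] Bup[of "v + w"] by linarith
      also have "\<dots> \<le> r * 4"
      proof (rule mult_left_mono[OF _ \<open>0 \<le> r\<close>])
        have "0 \<le> (v - w) \<bullet> (v - w)" by simp
        then show "(v + w) \<bullet> (v + w) \<le> 4" using n1 by (simp add: algebra_simps inner_commute)
      qed
      finally have "w \<bullet> B v \<le> r" by simp
      moreover have "B v = (1 / norm x) *\<^sub>R B x" using blB by (simp add: v_def linear_simps)
      ultimately show ?thesis using False
        by (simp add: w_def field_simps power2_norm_eq_inner[symmetric] power2_eq_square)
    qed (use \<open>0 \<le> r\<close> blB in \<open>auto simp: linear_simps\<close>)
  qed
  \<comment> \<open>Self-adjointness is a closed condition preserved by \<open>g\<close>; it makes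
    the matrix of the fixed point symmetric. The ball of radius r is mapped into itself because (r +
    r^2) / 2 <= r.\<close>
  define K where "K = {Y :: (real^'n::_) \<Rightarrow>\<^sub>L (real^'n::_). norm Y \<le> r \<and> (\<forall>x y. x \<bullet> blinfun_apply Y y = blinfun_apply Y x \<bullet> y)}"
  define g where "g = (\<lambda>Y :: (real^'n::_) \<Rightarrow>\<^sub>L (real^'n::_). (1/2) *\<^sub>R (b + (Y o\<^sub>L Y)))"
  have gY: "blinfun_apply (g Y) x = (1/2) *\<^sub>R (B x + Y (Y x))" for Y x
    by (simp add: g_def blinfun.bilinear_simps b)
  have "closed K" unfolding K_def
    by (intro closed_Collect_conj closed_Collect_all closed_Collect_le closed_Collect_eq continuous_intros)
  have rr: "r * r \<le> r" using \<open>0 \<le> r\<close> \<open>r < 1\<close> by (simp add: mult_left_le)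
  have "\<exists>!Y\<in>K. g Y = Y"
  proof (rule Banach_fix[OF _ _ \<open>0 \<le> r\<close> \<open>r < 1\<close>])
    show "complete K" using \<open>closed K\<close> by (simp add: complete_eq_closed)
    have "0 \<in> K" using \<open>0 \<le> r\<close> by (simp add: K_def)
    then show "K \<noteq> {}" by blast
    show "g ` K \<subseteq> K"
    proof safe
      fix Y assume Y: "Y \<in> K"
      have "norm (b + (Y o\<^sub>L Y)) \<le> r + r * r"
        using Y \<open>0 \<le> r\<close> by (intro norm_triangle_mono nb order_trans[OF norm_blinfun_compose] mult_mono) (auto simp: K_def)
      then have "norm (g Y) \<le> r" using rr by (simp add: g_def)
      moreover have "x \<bullet> Y (Y y) = Y (Y x) \<bullet> y" for x y using Y by (simp add: K_def)
      ultimately show "g Y \<in> K" by (simp add: K_def gY inner_add_left inner_add_right Bsym)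
    qed
    fix Y Z assume YZ: "Y \<in> K" "Z \<in> K"
    \<comment> \<open>From Y^2 - Z^2 = Y (Y - Z) + (Y - Z) Z; both factors have norm at most r, so
      the Lipschitz constant is (r + r) / 2.\<close>
    have "g Y - g Z = (1/2) *\<^sub>R ((Y o\<^sub>L (Y - Z)) + ((Y - Z) o\<^sub>L Z))"
      by (rule blinfun_eqI) (simp add: gY blinfun.bilinear_simps algebra_simps)
    moreover have "norm ((Y o\<^sub>L (Y - Z)) + ((Y - Z) o\<^sub>L Z)) \<le> r * norm (Y - Z) + norm (Y - Z) * r"
      using YZ \<open>0 \<le> r\<close> by (intro norm_triangle_mono order_trans[OF norm_blinfun_compose] mult_mono) (auto simp: K_def)
    ultimately show "dist (g Y) (g Z) \<le> r * dist Y Z" by (simp add: dist_norm)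
  qed
  then obtain Y where Y: "Y \<in> K" "g Y = Y" by blast
  have YY: "2 *\<^sub>R Y x = B x + Y (Y x)" for x 
    using arg_cong[OF gY[of Y x, unfolded Y(2)], of "\<lambda>v. 2 *\<^sub>R v"] by simp
  define S where "S = matrix (\<lambda>x. sqrt c *\<^sub>R (x - Y x))"
  have Sx: "S *v x = sqrt c *\<^sub>R (x - Y x)" for x
  proof -
    have "linear (\<lambda>x. sqrt c *\<^sub>R (x - Y x))"
      by (intro linearI) (simp_all add: blinfun.bilinear_simps algebra_simps)
    then show ?thesis by (simp add: S_def matrix_works)
  qed
  have "transpose S = S" using Y(1)
    by (intro transpose_eqI) (simp add: Sx K_def inner_diff_left inner_diff_right)
  moreover have "0 < x \<bullet> (S *v x)" if "x \<noteq> 0" for x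
  proof -
    have "x \<bullet> Y x \<le> norm x * norm (Y x)" by (rule norm_cauchy_schwarz)
    also have "\<dots> \<le> norm x * (r * norm x)"
      using Y(1) by (intro mult_left_mono order_trans[OF norm_blinfun] mult_right_mono) (auto simp: K_def)
    also have "\<dots> = r * (x \<bullet> x)" by (simp add: power2_norm_eq_inner[symmetric] power2_eq_square)
    also have "\<dots> < 1 * (x \<bullet> x)" using that \<open>r < 1\<close> by (intro mult_strict_right_mono) auto
    finally show ?thesis using cd(1) by (simp add: Sx inner_diff_right)
  qed
  moreover have "S ** S = A"
  proof -
    have "S *v (S *v x) = A *v x" for x
    proof -
      have "S *v (S *v x) = c *\<^sub>R (x - 2 *\<^sub>R Y x + Y (Y x))"
        using cd(1) by (simp add: Sx blinfun.bilinear_simps algebra_simps scaleR_2)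
      also have "\<dots> = c *\<^sub>R (x - B x)" by (simp add: YY)
      also have "\<dots> = A *v x" using cd(1) by (simp add: B_def)
      finally show ?thesis .
    qed
    then show ?thesis by (simp add: matrix_eq flip: matrix_vector_mul_assoc)
  qed
  ultimately show ?thesis unfolding pos_def_def by blast
qed

lemma msqrt_pos_def:
  assumes "pos_def A"
  shows "pos_def (msqrt A)" "msqrt A ** msqrt A = A"
proof -
  have "\<exists>!S. pos_def S \<and> S ** S = A"
    using pos_def_sqrt_exists[OF assms] pos_def_sqrt_unique by metis
  from theI'[OF this] show "pos_def (msqrt A)" "msqrt A ** msqrt A = A" by (auto simp: msqrt_def)
qed

section \<open>Determinants, inverses and congruences of positive definite matrices\<close>

lemma pos_def_invertible: "pos_def A \<Longrightarrow> invertible A"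
  by (metis invertible_left_inverse matrix_left_invertible_ker inner_zero_right pos_def_eq_0)

text \<open>The square root makes the determinant a square, and the trivial kernel makes it
  nonzero.\<close>

lemma pos_def_det_pos:
  assumes "pos_def A"
  shows "0 < det A"
proof -
  have "det A = det (msqrt A) * det (msqrt A)" using msqrt_pos_def[OF assms] by (metis det_mul)
  moreover have "det A \<noteq> 0" using pos_def_invertible[OF assms] by (simp add: invertible_det_nz)
  ultimately show ?thesis by (metis mult_eq_0_iff not_real_square_gt_zero)
qed

lemma matrix_inv:
  fixes A :: "real^'n^'n"
  assumes "invertible A"
  shows "A ** matrix_inv A = mat 1" "matrix_inv A ** A = mat 1"
proof -
  from assms have "A ** matrix_inv A = mat 1 \<and> matrix_inv A ** A = mat 1"
    unfolding invertible_def matrix_inv_def by (rule someI_ex)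
  then show "A ** matrix_inv A = mat 1" "matrix_inv A ** A = mat 1" by auto
qed

lemma matrix_inv_eqI:
  fixes A :: "real^'n^'n"
  assumes "A ** B = mat 1"
  shows "matrix_inv A = B"
proof -
  have "invertible A" using assms invertible_right_inverse by blast
  then have "matrix_inv A ** A ** B = B" by (simp add: matrix_inv)
  then show ?thesis by (metis assms matrix_mul_assoc matrix_mul_rid)
qed

lemma pos_def_congruence:
  fixes A T :: "real^'n::{finite,linorder}^'n::{finite,linorder}"
  assumes "pos_def A" "invertible T"
  shows "pos_def (T ** A ** transpose T)"
proof -
  have "psd (T ** A ** transpose T)"
    using psd_congruence[OF pos_def_imp_psd[OF assms(1)], of "transpose T"] by simp
  moreover have "0 < x \<bullet> ((T ** A ** transpose T) *v x)" if "x \<noteq> 0" for x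
  proof -
    have "invertible (transpose T)" using assms(2) by (rule transpose_invertible)
    then have "transpose T *v x \<noteq> 0" using that
      by (metis invertible_left_inverse matrix_left_invertible_ker)
    moreover have "x \<bullet> ((T ** A ** transpose T) *v x) = (transpose T *v x) \<bullet> (A *v (transpose T *v x))"
      by (simp add: dot_lmul_matrix flip: matrix_vector_mul_assoc)
    ultimately show ?thesis using assms(1) unfolding pos_def_def by metis
  qed
  ultimately show ?thesis unfolding pos_def_def psd_def by blast
qed

lemma pos_def_matrix_inv:
  fixes A :: "real^'n::{finite,linorder}^'n::{finite,linorder}"
  assumes "pos_def A"
  shows "pos_def (matrix_inv A)"
proof -
  have inv: "invertible A" using assms by (rule pos_def_invertible)
  have tr: "transpose A = A" using assms by (simp add: pos_def_def)
  let ?B = "matrix_inv A"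
  have i: "invertible ?B" using inv matrix_inv invertible_def by blast
  have "transpose ?B = ?B"
    by (metis inv matrix_inv(2) matrix_inv_eqI matrix_transpose_mul tr transpose_mat)
  then have "?B ** A ** transpose ?B = ?B" by (simp add: matrix_inv inv)
  then show ?thesis using pos_def_congruence[OF assms i] by simp
qed

section \<open>Matrix powers and their traces\<close>

lemma mpow_commute: "mpow A k ** A = A ** mpow A k"
  by (induction k) (auto simp: matrix_mul_assoc[symmetric])

text \<open>The induction goes in steps of two, since A^(j+2) is the congruence of A^j by the
  symmetric matrix A.\<close>

lemma psd_mpow:
  assumes "psd A"
  shows "psd (mpow A k)"
proof (induction k rule: nat_less_induct)
  case (1 k)
  consider "k = 0" | "k = 1" | j where "k = Suc (Suc j)" by (metis One_nat_def not0_implies_Suc)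
  then show ?case
  proof cases
    case 1
    then show ?thesis by (simp add: psd_def)
  next
    case 2
    then show ?thesis using assms by simp
  next
    case 3
    then have "mpow A k = transpose A ** mpow A j ** A"
      using assms by (simp add: psd_def mpow_commute matrix_mul_assoc[symmetric])
    then show ?thesis using 1 3 psd_congruence[of "mpow A j" A] by simp
  qed
qed

text \<open>A Bernoulli inequality for the trace. The increments of A^k change by A^(k+2) - 2
  A^(k+1) + A^k = (A - 1) A^k (A - 1), which has nonnegative trace, so every increment has trace at
  least that of the first, A - 1.\<close>

lemma trace_mpow_ge:
  fixes A :: "real^'n::{finite,linorder}^'n::{finite,linorder}"
  assumes A: "psd A"
  shows "real k * (trace A - real CARD('n)) + real CARD('n) \<le> trace (mpow A k)"
proof -
  let ?I = "mat 1 :: real^'n::_^'n::_"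
  have step: "0 \<le> trace (mpow A (Suc k) - mpow A k - (A - ?I))" for k
  proof (induction k)
    case 0
    show ?case by (simp add: trace_def)
  next
    case (Suc k)
    have t: "transpose (A - ?I) = A - ?I" using A by (simp add: psd_def transpose_def vec_eq_iff mat_def)
    have "mpow A (Suc (Suc k)) - mpow A (Suc k) - (A - ?I) = (mpow A (Suc k) - mpow A k - (A - ?I)) + transpose (A - ?I) ** mpow A k ** (A - ?I)"
      unfolding t by (simp add: matrix_diff_ldistrib matrix_diff_rdistrib mpow_commute matrix_mul_assoc[symmetric])
    then show ?case using Suc trace_psd_nonneg[OF psd_congruence[OF psd_mpow[OF A, of k], of "A - ?I"]]
      by (simp only: trace_add)
  qed
  show ?thesis
  proof (induction k)
    case (Suc k)
    then show ?case using step[of k, unfolded trace_sub trace_I] by (simp add: algebra_simps)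
  qed (simp add: trace_I)
qed

section \<open>The Jacobian of a congruence\<close>

text \<open>The substitution B -> S B S^T on the upper entries, extended by the identity on
  positions below the diagonal to give an endomorphism of the full space. Its determinant
  \<open>cong_det S\<close> is thus the Jacobian on symmetric matrices.\<close>

definition cong_lin :: "real^'n::{finite,linorder}^'n::{finite,linorder} \<Rightarrow> real^('n \<times> 'n) \<Rightarrow> real^('n \<times> 'n)" where
  "cong_lin S x = (\<chi> p. if p \<in> upper_idx then (S ** sym_of (($) x) ** transpose S) $ fst p $ snd p else x $ p)"

definition cong_det :: "real^'n::{finite,linorder}^'n::{finite,linorder} \<Rightarrow> real" where
  "cong_det S = det (matrix (cong_lin S))"

lemma sym_of_nth: "sym_of v $ i $ j = v (min i j, max i j)"
  by (simp add: sym_of_def)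

lemma transpose_sym_of: "transpose (sym_of v) = sym_of v"
  by (simp add: transpose_def vec_eq_iff sym_of_nth min.commute max.commute)

lemma sym_of_upper:
  assumes "\<And>i j. i \<le> j \<Longrightarrow> v (i, j) = A$i$j" "transpose A = A"
  shows "sym_of v = A"
proof -
  have "A$j$i = A$i$j" for i j
  proof -
    have "transpose A $ i $ j = A $ i $ j" by (simp add: assms)
    then show ?thesis by (simp add: transpose_def)
  qed
  then show ?thesis by (auto simp: vec_eq_iff sym_of_nth assms(1) min_def max_def)
qed

lemma sym_of_cong_lin: "sym_of (($) (cong_lin S x)) = S ** sym_of (($) x) ** transpose S"
  by (rule sym_of_upper)
     (simp_all add: cong_lin_def upper_idx_def matrix_transpose_mul transpose_sym_of matrix_mul_assoc)

lemma sym_of_add: "sym_of (($) (x + y)) = sym_of (($) x) + sym_of (($) y)"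
  by (simp add: vec_eq_iff sym_of_nth)

lemma sym_of_scaleR: "sym_of (($) (c *\<^sub>R x)) = c *\<^sub>R sym_of (($) x)"
  by (simp add: vec_eq_iff sym_of_nth)

lemma matrix_add_rdistrib: "(A + B) ** C = A ** C + (B :: real^'n^'m) ** C"
  by (simp add: matrix_matrix_mult_def vec_eq_iff algebra_simps sum.distrib)

lemma matrix_scaleR_left: "(c *\<^sub>R A) ** B = c *\<^sub>R (A ** (B :: real^'n^'m))"
  by (simp add: matrix_matrix_mult_def vec_eq_iff sum_distrib_left mult.assoc)

lemma matrix_scaleR_right: "A ** (c *\<^sub>R B) = c *\<^sub>R (A ** (B :: real^'n^'m))"
  by (simp add: matrix_matrix_mult_def vec_eq_iff sum_distrib_left mult_ac)

lemma linear_cong_lin: "linear (cong_lin S)"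
  by (rule linearI)
     (simp_all add: vec_eq_iff cong_lin_def sym_of_add sym_of_scaleR matrix_add_ldistrib
       matrix_add_rdistrib matrix_scaleR_left matrix_scaleR_right)

lemma cong_lin_mult: "cong_lin (S ** T) = cong_lin S \<circ> cong_lin T"
proof
  fix x
  have "(S ** T) ** sym_of (($) x) ** transpose (S ** T) = S ** sym_of (($) (cong_lin T x)) ** transpose S"
    by (simp add: sym_of_cong_lin matrix_transpose_mul matrix_mul_assoc)
  then show "cong_lin (S ** T) x = (cong_lin S \<circ> cong_lin T) x"
    by (simp add: cong_lin_def vec_eq_iff)
qed

lemma cong_det_mult: "cong_det (S ** T) = cong_det S * cong_det T"
  by (simp add: cong_det_def cong_lin_mult matrix_compose linear_cong_lin det_mul)

lemma cong_det_mat1: "cong_det (mat 1 :: real^'n::{finite,linorder}^'n::{finite,linorder}) = 1"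
proof -
  have "cong_lin (mat 1 :: real^'n::_^'n::_) = id"
    by (auto simp: cong_lin_def vec_eq_iff upper_idx_def sym_of_nth fun_eq_iff min_def max_def)
  then show ?thesis by (simp only: cong_det_def matrix_id)
qed

text \<open>Swapping the pairs behind the second factors sends them to the lower triangle with the
  diagonal. Together with the first factors they fill the whole square, giving p copies of each
  \<open>a i\<close>, and the doubly covered diagonal gives one more.\<close>

lemma prod_upper_idx:
  fixes a :: "'n::{finite,linorder} \<Rightarrow> real"
  shows "(\<Prod>p\<in>upper_idx. a (fst p) * a (snd p)) = (\<Prod>i\<in>UNIV. a i) ^ (CARD('n) + 1)"
proof -
  let ?L = "{p :: 'n \<times> 'n. snd p < fst p}" and ?D = "{p :: 'n \<times> 'n. fst p = snd p}"
  have sw: "(\<Prod>p\<in>upper_idx. a (snd p)) = (\<Prod>p\<in>?L \<union> ?D. a (fst p))"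
    by (rule prod.reindex_bij_witness[of _ prod.swap prod.swap]) (auto simp: upper_idx_def)
  have D: "(\<Prod>p\<in>?D. a (fst p)) = (\<Prod>i\<in>UNIV. a i)"
    by (rule prod.reindex_bij_witness[of _ "\<lambda>i. (i, i)" fst]) auto
  have "(\<Prod>p\<in>upper_idx. a (fst p) * a (snd p)) = (\<Prod>p\<in>upper_idx. a (fst p)) * (\<Prod>p\<in>?L \<union> ?D. a (fst p))"
    by (simp add: prod.distrib sw)
  also have "(\<Prod>p\<in>?L \<union> ?D. a (fst p)) = (\<Prod>p\<in>?L. a (fst p)) * (\<Prod>i\<in>UNIV. a i)"
    unfolding D[symmetric] by (rule prod.union_disjoint) auto
  also have "(\<Prod>p\<in>upper_idx. a (fst p)) * ((\<Prod>p\<in>?L. a (fst p)) * (\<Prod>i\<in>UNIV. a i)) =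
      (\<Prod>p\<in>upper_idx \<union> ?L. a (fst p)) * (\<Prod>i\<in>UNIV. a i)"
    by (subst prod.union_disjoint) (auto simp: upper_idx_def)
  also have "upper_idx \<union> ?L = UNIV \<times> UNIV" by (auto simp: upper_idx_def)
  also have "(\<Prod>p\<in>UNIV \<times> (UNIV :: 'n set). a (fst p)) = (\<Prod>i\<in>UNIV. \<Prod>j\<in>(UNIV :: 'n set). a i)"
    unfolding prod.cartesian_product by (simp only: split_def)
  also have "\<dots> = (\<Prod>i\<in>UNIV. a i) ^ CARD('n)"
    by (simp add: prod_power_distrib)
  finally show ?thesis by simp
qed

text \<open>For diagonal \<open>A\<close> the map \<open>cong_lin A\<close> is itself diagonal: it
  scales the upper position (i, j) by A_ii A_jj.\<close>

lemma cong_det_diagonal: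
  fixes A :: "real^'n::{finite,linorder}^'n::{finite,linorder}"
  assumes A: "\<And>i j. i \<noteq> j \<Longrightarrow> A$i$j = 0"
  shows "cong_det A = det A ^ (CARD('n) + 1)"
proof -
  have e: "(A ** M ** transpose A) $ i $ j = A$i$i * M$i$j * A$j$j" for M i j
  proof -
    have "(A ** M) $ i $ k = (\<Sum>l\<in>{i}. A$i$l * M$l$k)" for k
      unfolding matrix_matrix_mult_def vec_lambda_beta
      by (rule sum.mono_neutral_right) (use A in auto)
    moreover have "(A ** M ** transpose A) $ i $ j = (\<Sum>k\<in>{j}. (A ** M) $ i $ k * transpose A $ k $ j)"
      unfolding matrix_matrix_mult_def[of "A ** M"] vec_lambda_beta
      by (rule sum.mono_neutral_right) (use A in \<open>auto simp: transpose_def\<close>)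
    ultimately show ?thesis by (simp add: transpose_def)
  qed
  have f: "matrix (cong_lin A) $ p $ q = (if p = q then if p \<in> upper_idx then A$(fst p)$(fst p) * A$(snd p)$(snd p) else 1 else 0)" for p q
    by (cases p) (auto simp: matrix_def cong_lin_def e sym_of_nth upper_idx_def axis_def min_def max_def)
  have "cong_det A = (\<Prod>p\<in>UNIV. if p \<in> upper_idx then A$(fst p)$(fst p) * A$(snd p)$(snd p) else 1)"
    unfolding cong_det_def by (subst det_diagonal) (auto simp: f)
  also have "\<dots> = (\<Prod>p\<in>upper_idx. A$(fst p)$(fst p) * A$(snd p)$(snd p))"
    by (simp add: prod.If_cases)
  also have "\<dots> = det A ^ (CARD('n) + 1)"
    unfolding prod_upper_idx[of "\<lambda>i. A$i$i"] by (simp add: det_diagonal A)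
  finally show ?thesis .
qed

text \<open>If E is conjugate to E^2, a multiplicative function has h E = (h E)^2, and h E is
  nonzero because E has an inverse. Applied to both \<open>det\<close> and \<open>cong_det\<close>,
  this evaluates them on an elementary row addition without expanding its Jacobian.\<close>

lemma multiplicative_eq_1:
  fixes h :: "real^'n^'n \<Rightarrow> real"
  assumes h: "\<And>A B. h (A ** B) = h A * h B" "h (mat 1) = 1"
    and "D ** D' = mat 1" "D ** E ** D' = E ** E" "E ** E' = mat 1"
  shows "h E = 1"
proof -
  have "h E * h E' = 1" "h D * h D' = 1" "h D * h E * h D' = h E * h E"
    using assms(3-5) by (simp_all add: h(2) flip: h(1))
  then have "h E = h E * h E" "h E \<noteq> 0" by (auto simp: algebra_simps)
  then show ?thesis by simp
qed

lemma cong_det: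
  fixes S :: "real^'n::{finite,linorder}^'n::{finite,linorder}"
  assumes "det S \<noteq> 0"
  shows "\<bar>cong_det S\<bar> = \<bar>det S\<bar> ^ (CARD('n) + 1)"
proof -
  define P where "P S \<longleftrightarrow> det S = 0 \<or> \<bar>cong_det S\<bar> = \<bar>det S\<bar> ^ (CARD('n) + 1)" for S :: "real^'n::_^'n::_"
  have "P S"
  proof (rule induct_matrix_elementary_alt)
    show "P (A ** B)" if "P A" "P B" for A B
      using that by (auto simp: P_def det_mul cong_det_mult abs_mult power_mult_distrib)
    show "P A" if "row i A = 0" for A i
      using that by (simp add: P_def det_zero_row)
    show "P A" if "\<And>i j. i \<noteq> j \<Longrightarrow> A$i$j = 0" for A
      using cong_det_diagonal[OF that] by (simp add: P_def power_abs abs_mult)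
    have inv1: "\<bar>x\<bar> = 1" if "x * x = 1" for x :: real
      using that by (metis abs_1 abs_mult_self_eq power2_eq_square real_sqrt_abs real_sqrt_one)
    show "P (\<chi> i j. mat 1 $ i $ Transposition.transpose m n j)" (is "P ?S") for m n
    proof -
      \<comment> \<open>A transposition is an involution, so both multiplicative functions take a
        value whose square is 1; this fixes their absolute values.\<close>
      have "?S ** ?S = mat 1"
      proof -
        have "(?S ** ?S) $ i $ j = (\<Sum>k\<in>UNIV. if k = Transposition.transpose m n i then ?S $ k $ j else 0)" for i j
          unfolding matrix_matrix_mult_def vec_lambda_beta by (intro sum.cong) (auto simp: mat_def)
        then show ?thesis by (auto simp: vec_eq_iff mat_def transpose_eq_iff)
      qed
      then have "det ?S * det ?S = 1" "cong_det ?S * cong_det ?S = 1"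
        by (simp_all add: cong_det_mat1 flip: det_mul cong_det_mult)
      then show ?thesis by (simp add: P_def inv1)
    qed
    show "P (\<chi> i j. of_bool (i = m \<and> j = n \<or> i = j))" (is "P ?E") if mn: "m \<noteq> n" for m n :: 'n
    proof (cases "det ?E = 0")
      case False
      \<comment> \<open>Conjugation with \<open>D 2\<close> doubles the entry of \<open>?E\<close>
        at \<open>(m, n)\<close>, and squaring \<open>?E\<close> has the same effect.\<close>
      define D where "D c = (\<chi> i j. if i = j then if i = m then c else 1 else 0 :: real^'n::_^'n::_)" for c :: real
      have Dl: "(D c ** M) $ i $ j = (if i = m then c else 1) * M $ i $ j" for c M i j
      proof -
        have "(D c ** M) $ i $ j = (\<Sum>k\<in>UNIV. if k = i then (if i = m then c else 1) * M $ i $ j else 0)"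
          unfolding matrix_matrix_mult_def vec_lambda_beta by (intro sum.cong) (auto simp: D_def)
        then show ?thesis by simp
      qed
      have Dr: "(M ** D c) $ i $ j = M $ i $ j * (if j = m then c else 1)" for c M i j
      proof -
        have "(M ** D c) $ i $ j = (\<Sum>k\<in>UNIV. if k = j then M $ i $ j * (if j = m then c else 1) else 0)"
          unfolding matrix_matrix_mult_def vec_lambda_beta by (intro sum.cong) (auto simp: D_def)
        then show ?thesis by simp
      qed
      have DD: "D 2 ** D (1/2) = mat 1" by (simp add: vec_eq_iff Dl) (simp add: D_def mat_def)
      have EE: "D 2 ** ?E ** D (1/2) = ?E ** ?E"
      proof -
        have "(?E ** ?E) $ i $ j = (\<Sum>k\<in>UNIV. (if k = i then ?E $ i $ j else 0) + (if k = n then if i = m then ?E $ n $ j else 0 else 0))" for i j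
          unfolding matrix_matrix_mult_def vec_lambda_beta by (intro sum.cong) (use mn in auto)
        then have "(?E ** ?E) $ i $ j = ?E $ i $ j + (if i = m then ?E $ n $ j else 0)" for i j
          by (simp only: sum.distrib) simp
        then show ?thesis using mn by (auto simp: vec_eq_iff Dl Dr)
      qed
      obtain E' where E': "?E ** E' = mat 1" using False by (auto simp: invertible_def simp flip: invertible_det_nz)
      have "det ?E = 1" "cong_det ?E = 1"
        by (rule multiplicative_eq_1[of det, OF det_mul det_I DD EE E'],
            rule multiplicative_eq_1[of cong_det, OF cong_det_mult cong_det_mat1 DD EE E'])
      then show ?thesis by (simp add: P_def)
    qed (simp add: P_def)
  qed
  then show ?thesis using assms by (simp add: P_def)
qed

lemma nn_integral_congruence:
  fixes S :: "real^'n::{finite,linorder}^'n::{finite,linorder}"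
  assumes "det S \<noteq> 0" and G: "G \<in> borel_measurable (LP upper_idx)"
  shows "ennreal (\<bar>det S\<bar> ^ (CARD('n) + 1)) *
     (\<integral>\<^sup>+v. G (\<lambda>p\<in>upper_idx. (S ** sym_of v ** transpose S) $ fst p $ snd p) \<partial>LP upper_idx) = (\<integral>\<^sup>+v. G v \<partial>LP upper_idx)"
proof -
  have e: "(\<lambda>p\<in>upper_idx. (S ** sym_of v ** transpose S) $ fst p $ snd p) = (\<lambda>p\<in>upper_idx. cong_lin S (\<chi> j. v j) $ p)" for v
  proof -
    have "sym_of (($) (vec_lambda v)) = sym_of v" by (simp add: sym_of_def)
    then show ?thesis by (simp add: cong_lin_def fun_eq_iff)
  qed
  have "cong_det S \<noteq> 0" using cong_det[OF assms(1)] assms(1) by auto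
  then show ?thesis unfolding e cong_det[OF assms(1), symmetric] unfolding cong_det_def
  proof (intro nn_integral_PiM_linear linear_cong_lin G)
    show "cong_lin S x $ i = x $ i" if "i \<notin> upper_idx" for x i using that by (simp add: cong_lin_def)
    show "cong_lin S x $ i = cong_lin S y $ i" if "\<And>j. j \<in> upper_idx \<Longrightarrow> x$j = y$j" "i \<in> upper_idx" for x y i
    proof -
      have "sym_of (($) x) = sym_of (($) y)"
        by (auto simp: vec_eq_iff sym_of_nth upper_idx_def intro!: that(1) min.coboundedI1 max.coboundedI1)
      then show ?thesis using that(2) by (simp add: cong_lin_def)
    qed
  qed
qed

section \<open>Bordering a positive definite block\<close>

lemma borel_measurable_matrix:
  fixes F :: "'a \<Rightarrow> real^'m^'n"
  assumes "\<And>i j. (\<lambda>v. F v $ i $ j) \<in> borel_measurable M"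
  shows "F \<in> borel_measurable M"
  by (subst borel_measurable_euclidean_space) (auto simp: Basis_vec_def inner_axis assms)

lemma continuous_on_det: "continuous_on A (det :: real^'n^'n \<Rightarrow> real)"
  unfolding det_def by (intro continuous_intros)

lemma borel_measurable_det [measurable]: "(det :: real^'n^'n \<Rightarrow> real) \<in> borel_measurable borel"
  by (rule borel_measurable_continuous_onI[OF continuous_on_det])

text \<open>Strict positivity at every nonzero vector is, by compactness of the sphere, a uniform
  lower bound. Taking the bound from the sequence 1 / (n + 1) exhibits the cone as a countable union
  of closed sets.\<close>

lemma sets_pos_def [measurable]:
  "Collect (pos_def :: real^'n::{finite,linorder}^'n::{finite,linorder} \<Rightarrow> bool) \<in> sets borel"
proof -
  have "pos_def A \<longleftrightarrow> transpose A = A \<and> (\<exists>n. \<forall>x. x \<bullet> x \<le> real (Suc n) * (x \<bullet> (A *v x)))" for A :: "real^'n::_^'n::_"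
  proof (intro iffI conjI)
    assume A: "pos_def A"
    obtain c d where d: "0 < d" "\<And>x. d * (x \<bullet> x) \<le> x \<bullet> (A *v x)" using pos_def_bounds[OF A] by metis
    obtain n where n: "1 / d < real (Suc n)" using reals_Archimedean2[of "1/d"] by (meson less_SucI of_nat_less_iff lessI less_trans)
    have "x \<bullet> x \<le> real (Suc n) * (x \<bullet> (A *v x))" for x
    proof -
      have "x \<bullet> x \<le> (1 / d) * (x \<bullet> (A *v x))" using d by (simp add: field_simps)
      also have "\<dots> \<le> real (Suc n) * (x \<bullet> (A *v x))"
        using n pos_def_imp_psd[OF A] by (intro mult_right_mono) (auto simp: psd_def)
      finally show ?thesis .
    qed
    then show "\<exists>n. \<forall>x. x \<bullet> x \<le> real (Suc n) * (x \<bullet> (A *v x))" by blast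
  next
    assume "transpose A = A \<and> (\<exists>n. \<forall>x. x \<bullet> x \<le> real (Suc n) * (x \<bullet> (A *v x)))"
    then obtain n where t: "transpose A = A" and n: "\<And>x. x \<bullet> x \<le> real (Suc n) * (x \<bullet> (A *v x))" by blast
    have "0 < x \<bullet> (A *v x)" if "x \<noteq> 0" for x
    proof -
      have "0 < real (Suc n) * (x \<bullet> (A *v x))" using n[of x] that by (meson inner_gt_zero_iff less_le_trans)
      then show ?thesis by (simp add: zero_less_mult_iff)
    qed
    with t show "pos_def A" by (simp add: pos_def_def)
  qed (simp add: pos_def_def)
  then have e: "Collect (pos_def :: real^'n::_^'n::_ \<Rightarrow> bool) =
     {A. transpose A = A} \<inter> (\<Union>n. {A. \<forall>x. x \<bullet> x \<le> real (Suc n) * (x \<bullet> (A *v x))})" by blast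
  have c1: "closed {A :: real^'n::_^'n::_. transpose A = A}"
    unfolding transpose_def by (intro closed_Collect_eq continuous_intros)
  have c2: "closed {A :: real^'n::_^'n::_. \<forall>x. x \<bullet> x \<le> real (Suc n) * (x \<bullet> (A *v x))}" for n
    unfolding matrix_vector_mult_def by (intro closed_Collect_all closed_Collect_le continuous_intros)
  show ?thesis unfolding e by (intro sets.Int sets.countable_UN image_subsetI borel_closed c1 c2)
qed

text \<open>The leading blocks of a symmetric matrix are kept at full size by padding with an identity block,
  so that induction on the size of the block stays within one matrix type.\<close>

definition block_idx :: "'n::{finite,linorder} set \<Rightarrow> ('n \<times> 'n) set" where
  "block_idx I = {(i, j). i \<le> j \<and> i \<in> I \<and> j \<in> I}"

definition block :: "'n::{finite,linorder} set \<Rightarrow> ('n \<times> 'n \<Rightarrow> real) \<Rightarrow> real^'n::{finite,linorder}^'n::{finite,linorder}" where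
  "block I v = (\<chi> i j. if i \<in> I \<and> j \<in> I then v (min i j, max i j) else of_bool (i = j))"

text \<open>The extra 1 is added only at positions in \<open>I\<close>. The padding keeps its
  entries 1, so the determinant is that of 1 + B for the block B alone, without powers of 2.\<close>

definition block1 :: "'n::{finite,linorder} set \<Rightarrow> ('n \<times> 'n \<Rightarrow> real) \<Rightarrow> real^'n::{finite,linorder}^'n::{finite,linorder}" where
  "block1 I v = block I v + (\<chi> i j. of_bool (i = j \<and> i \<in> I))"

lemma block_measurable [measurable]: "block I \<in> borel_measurable (LP (block_idx I))"
proof (rule borel_measurable_matrix)
  fix i j
  show "(\<lambda>v. block I v $ i $ j) \<in> borel_measurable (LP (block_idx I))"
  proof (cases "i \<in> I \<and> j \<in> I")
    case True
    then have "(min i j, max i j) \<in> block_idx I" by (auto simp: block_idx_def min_def max_def)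
    then have "(\<lambda>v. v (min i j, max i j)) \<in> borel_measurable (LP (block_idx I))"
      using measurable_component_singleton[of "(min i j, max i j)" "block_idx I" "\<lambda>_. lborel"] by simp
    with True show ?thesis by (simp add: block_def)
  next
    case False
    then have "(\<lambda>v. block I v $ i $ j) = (\<lambda>v. of_bool (i = j))" by (auto simp: block_def)
    then show ?thesis by simp
  qed
qed

lemma block1_measurable [measurable]: "block1 I \<in> borel_measurable (LP (block_idx I))"
  unfolding block1_def[abs_def] by measurable

lemma transpose_block: "transpose (block I v) = block I v"
  by (auto simp: block_def transpose_def vec_eq_iff min.commute max.commute)

lemma transpose_block1: "transpose (block1 I v) = block1 I v"
  by (auto simp: block1_def block_def transpose_def vec_eq_iff min.commute max.commute)

lemma block1_quadratic_form:
  "x \<bullet> (block1 I v *v y) = x \<bullet> (block I v *v y) + (\<Sum>i\<in>I. x$i * y$i)"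
proof -
  have "((\<chi> i j. of_bool (i = j \<and> i \<in> I)) *v y) $ i = (if i \<in> I then y $ i else 0)" for i :: 'a
  proof -
    have "((\<chi> i j. of_bool (i = j \<and> i \<in> I)) *v y) $ i = (\<Sum>j\<in>UNIV. if j = i then (if i \<in> I then y $ i else 0) else 0)"
      unfolding matrix_vector_mult_def vec_lambda_beta by (rule sum.cong) auto
    then show ?thesis by simp
  qed
  then have "x \<bullet> ((\<chi> i j. of_bool (i = j \<and> i \<in> I)) *v y) = (\<Sum>i\<in>UNIV. if i \<in> I then x$i * y$i else 0)"
    unfolding inner_vec_def by (intro sum.cong) auto
  also have "\<dots> = (\<Sum>i\<in>I. x$i * y$i)" by (simp add: sum.If_cases)
  finally show ?thesis by (simp add: block1_def matrix_vector_mult_add_rdistrib inner_add_right)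
qed

lemma pos_def_block1: "pos_def (block I v) \<Longrightarrow> pos_def (block1 I v)"
  unfolding pos_def_def transpose_block1 block1_quadratic_form
  by (auto intro!: add_pos_nonneg sum_nonneg)

section \<open>The two one-dimensional integrals\<close>

lemma nn_integral_inverse_1_plus_sq_finite:
  "(\<integral>\<^sup>+x. ennreal (inverse (1 + x\<^sup>2)) \<partial>lborel) < \<infinity>"
proof -
  let ?h = "\<lambda>x::real. ennreal (inverse (1 + x\<^sup>2))"
  have "(\<integral>\<^sup>+x. ?h x * indicator {0..} x \<partial>lborel) = ennreal (pi/2 - arctan 0)"
    by (rule nn_integral_FTC_atLeast) (auto intro!: DERIV_arctan tendsto_arctan_at_top)
  then have half: "(\<integral>\<^sup>+x. ?h x * indicator {0..} x \<partial>lborel) < \<infinity>" by simp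
  have "(\<integral>\<^sup>+x. ?h x * indicator {..0} x \<partial>lborel) = (\<integral>\<^sup>+x. ?h x * indicator {0..} x \<partial>lborel)"
    by (subst nn_integral_real_affine[where c="-1" and t=0])
       (auto intro!: nn_integral_cong split: split_indicator)
  moreover have "(\<integral>\<^sup>+x. ?h x \<partial>lborel) \<le> (\<integral>\<^sup>+x. ?h x * indicator {0..} x + ?h x * indicator {..0} x \<partial>lborel)"
    by (intro nn_integral_mono) (auto split: split_indicator)
  ultimately have "(\<integral>\<^sup>+x. ?h x \<partial>lborel) \<le> (\<integral>\<^sup>+x. ?h x * indicator {0..} x \<partial>lborel) + (\<integral>\<^sup>+x. ?h x * indicator {0..} x \<partial>lborel)"
    by (subst (asm) nn_integral_add) auto
  also have "\<dots> < \<infinity>" using half by simp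
  finally show ?thesis .
qed

lemma nn_integral_powr_tail_finite:
  "(\<integral>\<^sup>+x. ennreal ((1 + x) powr (-3/2)) * indicator {0<..} x \<partial>lborel) < \<infinity>"
proof -
  have "(\<integral>\<^sup>+x. ennreal ((1 + x) powr (-3/2)) * indicator {0..} x \<partial>lborel) = ennreal (0 - (- 2 * (1 + 0) powr (-1/2)))"
  proof (rule nn_integral_FTC_atLeast)
    show "((\<lambda>x::real. - 2 * (1 + x) powr (-1/2)) has_real_derivative (1 + x) powr (-3/2)) (at x)" if "0 \<le> x" for x
      using that by (auto intro!: derivative_eq_intros)
    show "((\<lambda>x::real. - 2 * (1 + x) powr (-1/2)) \<longlongrightarrow> 0) at_top"
      by (intro tendsto_mult_right_zero tendsto_neg_powr filterlim_tendsto_add_at_top[OF tendsto_const filterlim_ident]) auto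
  qed auto
  then have "(\<integral>\<^sup>+x. ennreal ((1 + x) powr (-3/2)) * indicator {0..} x \<partial>lborel) < \<infinity>" by simp
  then show ?thesis
    by (rule le_less_trans[rotated]) (intro nn_integral_mono, auto split: split_indicator)
qed


text \<open>The added row has no component at \<open>k\<close>, so it lies in the span of the other
  rows. This is the unipotent factor in the factorisation of a bordered matrix.\<close>

lemma det_mat1_plus_row:
  fixes c :: "real^'n"
  assumes "c $ k = 0"
  shows "det (\<chi> i j. of_bool (i = j) + (if i = k then c $ j else 0)) = 1"
proof -
  have r: "row j (mat 1 :: real^'n^'n) = axis j 1" for j by (simp add: row_def mat_def axis_def vec_eq_iff)
  have "c = (\<Sum>j\<in>UNIV - {k}. c $ j *s axis j 1)"
    using basis_expansion[of c] assms by (simp add: sum.remove[of UNIV k])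
  also have "\<dots> \<in> vec.span {row j (mat 1 :: real^'n^'n) |j. j \<noteq> k}"
    by (intro vec.span_sum vec.span_scale vec.span_base) (auto simp: r)
  finally have "det (\<chi> i. if i = k then row k (mat 1) + c else row i (mat 1 :: real^'n^'n)) = det (mat 1 :: real^'n^'n)"
    by (rule det_row_span)
  moreover have "(\<chi> i. if i = k then row k (mat 1) + c else row i (mat 1 :: real^'n^'n)) =
      (\<chi> i j. of_bool (i = j) + (if i = k then c $ j else 0))"
    by (auto simp: vec_eq_iff row_def mat_def)
  ultimately show ?thesis by simp
qed

section \<open>Positivity and determinant of a bordered block\<close>

lemma block_outside:
  "i \<notin> I \<Longrightarrow> block I v $ i $ j = of_bool (i = j)" "j \<notin> I \<Longrightarrow> block I v $ i $ j = of_bool (i = j)"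
  by (auto simp: block_def)

lemma block1_outside:
  "i \<notin> I \<Longrightarrow> block1 I v $ i $ j = of_bool (i = j)" "j \<notin> I \<Longrightarrow> block1 I v $ i $ j = of_bool (i = j)"
  by (auto simp: block1_def block_def)

lemma block1_mult_outside: "i \<notin> I \<Longrightarrow> (block1 I v *v x) $ i = x $ i"
  by (simp add: matrix_vector_mult_def block1_outside)

text \<open>Removing the component of \<open>x\<close> at \<open>k\<close> gives a vector
  \<open>y\<close> on which the bordered and the padded form agree. The padding contributes only the
  square of the removed component.\<close>

lemma pos_def_block_insert_imp:
  fixes v w :: "'n::{finite,linorder} \<times> 'n \<Rightarrow> real"
  assumes k: "k \<notin> I" and w: "\<And>p. p \<in> block_idx I \<Longrightarrow> w p = v p"
    and pd: "pos_def (block (insert k I) w)"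
  shows "pos_def (block I v)"
  unfolding pos_def_def
proof (intro conjI allI impI transpose_block)
  let ?A = "block I v" and ?A' = "block (insert k I) w"
  fix x :: "real^'n::_" assume "x \<noteq> 0"
  have Ak: "?A *v axis k 1 = axis k 1"
    unfolding matrix_vector_mult_basis using k by (auto simp: column_def vec_eq_iff block_outside axis_def)
  have kA: "(?A *v x) $ k = x $ k" for x
    using k by (simp add: matrix_vector_mult_def block_outside)
  define y where "y = x - x$k *\<^sub>R axis k 1"
  have yk: "y $ k = 0" by (simp add: y_def)
  have "x = y + x$k *\<^sub>R axis k 1" by (simp add: y_def)
  then have "x \<bullet> (?A *v x) = (y + x$k *\<^sub>R axis k 1) \<bullet> (?A *v (y + x$k *\<^sub>R axis k 1))" by simp
  then have xy: "x \<bullet> (?A *v x) = y \<bullet> (?A *v y) + (x$k)\<^sup>2"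
    by (simp add: matrix_vector_right_distrib matrix_vector_mult_scaleR Ak kA inner_add_left inner_add_right
        inner_axis inner_axis' yk power2_eq_square)
  have "?A' $ i $ j = ?A $ i $ j" if "i \<noteq> k" "j \<noteq> k" for i j
    using that w[of "(min i j, max i j)"] by (auto simp: block_def block_idx_def min_def max_def)
  then have "(?A' *v y) $ i = (?A *v y) $ i" if "i \<noteq> k" for i
    unfolding matrix_vector_mult_def vec_lambda_beta using that by (intro sum.cong refl) (metis mult_zero_right yk)
  then have "y \<bullet> (?A' *v y) = y \<bullet> (?A *v y)"
    unfolding inner_vec_def by (intro sum.cong refl) (metis inner_zero_left yk)
  moreover have "0 < y \<bullet> (?A' *v y)" if "y \<noteq> 0"
    using pd that by (simp add: pos_def_def)
  moreover have "y \<noteq> 0 \<or> x$k \<noteq> 0" using \<open>x \<noteq> 0\<close> by (auto simp: y_def)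
  ultimately show "0 < x \<bullet> (?A *v x)" unfolding xy
    by (cases "y = 0") (auto intro: add_pos_nonneg)
qed

text \<open>The border is b = (1 + B) c, so \<open>1 + g\<close> is the Schur complement of 1 + B in
  the identity plus the bordered matrix. As \<open>k\<close> exceeds every element of
  \<open>I\<close>, \<open>(i, k)\<close> is the position at which the border entry is
  stored.\<close>

context
  fixes I :: "'n::{finite,linorder} set" and k v w and c :: "real^'n::{finite,linorder}" and g :: real
  assumes k: "\<And>i. i \<in> I \<Longrightarrow> i < k"
    and c: "\<And>i. i \<notin> I \<Longrightarrow> c $ i = 0"
    and w: "\<And>p. p \<in> block_idx I \<Longrightarrow> w p = v p"
    and wk: "\<And>i. i \<in> I \<Longrightarrow> w (i, k) = (block1 I v *v c) $ i"
    and wkk: "w (k, k) = g + c \<bullet> (block1 I v *v c)"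
begin

private lemma kI: "k \<notin> I" using k by blast

private lemma ck: "c $ k = 0" using c kI by blast

private lemma Mck: "(block1 I v *v c) $ i = 0" if "i \<notin> I" using block1_mult_outside[OF that] c[OF that] by simp

private lemma block_insert_nth:
  "block (insert k I) w $ i $ j =
     (if i = k then if j = k then g + c \<bullet> (block1 I v *v c) else (block1 I v *v c) $ j
      else if j = k then (block1 I v *v c) $ i else block I v $ i $ j)"
proof -
  have "w (min i j, max i j) = v (min i j, max i j)" if "i \<in> I" "j \<in> I"
    using that by (intro w) (auto simp: block_idx_def min_def max_def)
  moreover have "min i k = i" "max i k = k" "min k i = i" "max k i = k" if "i \<in> I" for i
    using k[OF that] by auto
  ultimately show ?thesis using kI by (auto simp: block_def wk wkk Mck)
qed

text \<open>The enlarged matrix is \<open>L ** N ** transpose L\<close> with L = 1 + e_k c^T of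
  determinant 1. The middle factor \<open>N\<close> is \<open>block1 I v\<close> with its padding
  entry 1 at \<open>k\<close> replaced by \<open>1 + g\<close>, which is multiplication by the
  diagonal matrix \<open>D\<close>.\<close>

lemma det_block1_insert: "det (block1 (insert k I) w) = det (block1 I v) * (1 + g)"
proof -
  let ?M = "block1 I v"
  define L where "L = (\<chi> i j. of_bool (i = j) + (if i = k then c $ j else 0))"
  define D where "D = (\<chi> i j. if i = j then (if i = k then 1 + g else 1) else 0 :: real^'n::_^'n::_)"
  define N where "N = D ** ?M"
  have N: "N $ i $ j = ?M $ i $ j + (if i = k \<and> j = k then g else 0)" for i j
  proof -
    have "N $ i $ j = (\<Sum>l\<in>UNIV. if l = i then (if i = k then 1 + g else 1) * ?M $ i $ j else 0)"
      unfolding N_def matrix_matrix_mult_def vec_lambda_beta by (intro sum.cong) (auto simp: D_def)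
    then show ?thesis using kI by (auto simp: block1_outside)
  qed
  have sym: "?M $ i $ j = ?M $ j $ i" for i j
  proof -
    have "transpose ?M $ j $ i = ?M $ j $ i" by (simp add: transpose_block1)
    then show ?thesis by (simp add: transpose_def)
  qed
  have Nc: "(\<Sum>l\<in>UNIV. N $ i $ l * c $ l) = (?M *v c) $ i" for i
    unfolding matrix_vector_mult_def vec_lambda_beta by (intro sum.cong) (auto simp: N ck)
  have cN: "(\<Sum>l\<in>UNIV. c $ l * N $ l $ i) = (?M *v c) $ i" for i
    unfolding Nc[symmetric] by (intro sum.cong) (auto simp: N ck sym[of i] mult.commute)
  have cc: "c \<bullet> (?M *v c) = (\<Sum>l\<in>UNIV. (?M *v c) $ l * c $ l)"
    by (simp add: inner_vec_def mult.commute)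
  have LN: "(L ** N) $ i $ j = N $ i $ j + (if i = k then (?M *v c) $ j else 0)" for i j
  proof -
    have "(L ** N) $ i $ j = (\<Sum>l\<in>UNIV. (if l = i then N $ i $ j else 0) + (if i = k then c $ l * N $ l $ j else 0))"
      unfolding matrix_matrix_mult_def vec_lambda_beta by (intro sum.cong) (auto simp: L_def algebra_simps)
    then show ?thesis by (cases "i = k") (simp_all add: sum.distrib cN)
  qed
  have LNL: "(L ** N ** transpose L) $ i $ j = (L ** N) $ i $ j +
      (if j = k then (?M *v c) $ i + (if i = k then c \<bullet> (?M *v c) else 0) else 0)" for i j
  proof -
    have "(L ** N ** transpose L) $ i $ j = (\<Sum>l\<in>UNIV. (if l = j then (L ** N) $ i $ j else 0) + (if j = k then (L ** N) $ i $ l * c $ l else 0))"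
      unfolding matrix_matrix_mult_def[of "L ** N"] vec_lambda_beta
      by (intro sum.cong) (auto simp: L_def transpose_def algebra_simps)
    moreover have "(\<Sum>l\<in>UNIV. (L ** N) $ i $ l * c $ l) = (?M *v c) $ i + (if i = k then c \<bullet> (?M *v c) else 0)"
      by (cases "i = k") (simp_all add: LN distrib_right sum.distrib Nc cc)
    ultimately show ?thesis by (simp add: sum.distrib)
  qed
  have M': "block1 (insert k I) w $ i $ j = block (insert k I) w $ i $ j + of_bool (i = j \<and> i \<in> insert k I)" for i j
    by (simp add: block1_def)
  have M: "block I v $ i $ j = ?M $ i $ j - of_bool (i = j \<and> i \<in> I)" for i j
    by (simp add: block1_def)
  have "block1 (insert k I) w = L ** N ** transpose L"
    unfolding vec_eq_iff M' block_insert_nth LNL LN N M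
    using kI by (auto simp: block1_outside Mck)
  moreover have "det L = 1" unfolding L_def by (rule det_mat1_plus_row[OF ck])
  moreover have "det D = 1 + g"
  proof -
    have "det D = (\<Prod>i\<in>UNIV. if i = k then 1 + g else 1)"
      by (subst det_diagonal) (auto simp: D_def)
    then show ?thesis by simp
  qed
  ultimately show ?thesis by (simp add: det_mul det_transpose N_def)
qed

text \<open>The summand -1 in the coefficient of the square removes the padding entry at
  \<open>k\<close>, which the form of \<open>block I v\<close> already counts.\<close>

private lemma block_insert_form:
  "x \<bullet> (block (insert k I) w *v x) = x \<bullet> (block I v *v x) + (g + c \<bullet> (block1 I v *v c) - 1) * (x$k)\<^sup>2 + 2 * x$k * (x \<bullet> (block1 I v *v c))"
proof -
  let ?u = "block1 I v *v c" and ?b = "g + c \<bullet> (block1 I v *v c) - 1"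
  have e: "(block (insert k I) w *v x) $ i = (block I v *v x) $ i + ?u $ i * x $ k + (if i = k then ?b * x $ k + x \<bullet> ?u else 0)" for i
  proof -
    have "(block (insert k I) w *v x) $ i = (\<Sum>j\<in>UNIV. block I v $ i $ j * x $ j + (if j = k then ?u $ i * x $ k else 0)
        + (if i = k then (if j = k then ?b * x $ k else 0) + x $ j * ?u $ j else 0))"
      unfolding matrix_vector_mult_def[of "block (insert k I) w"] vec_lambda_beta
      by (intro sum.cong) (use kI in \<open>auto simp: block_insert_nth Mck algebra_simps block_outside\<close>)
    then show ?thesis by (cases "i = k") (simp_all add: sum.distrib matrix_vector_mult_def[of "block I v"] inner_vec_def)
  qed
  have "x \<bullet> (block (insert k I) w *v x) = (\<Sum>i\<in>UNIV. x$i * (block I v *v x) $ i + x$i * ?u $ i * x $ k + (if i = k then x$i * (?b * x $ k + x \<bullet> ?u) else 0))"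
    unfolding inner_vec_def[of x "block (insert k I) w *v x"] e
    by (intro sum.cong) (auto simp: algebra_simps)
  also have "\<dots> = x \<bullet> (block I v *v x) + (x \<bullet> ?u) * x $ k + x$k * (?b * x $ k + x \<bullet> ?u)"
    by (simp add: sum.distrib sum_distrib_right inner_vec_def)
  finally show ?thesis by (simp add: power2_eq_square algebra_simps)
qed

text \<open>The test vector is e_k - c. There the form of the identity plus the bordered matrix has
  the value \<open>1 + g\<close>; subtracting the squared norm 1 + |c|^2 leaves g - |c|^2 for the
  bordered matrix itself, which must be positive.\<close>

lemma pos_def_block_insert_gap:
  assumes "pos_def (block (insert k I) w)"
  shows "(\<Sum>i\<in>I. (c$i)\<^sup>2) < g"
proof -
  let ?A = "block I v"
  have Ak: "?A *v axis k 1 = axis k 1"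
    unfolding matrix_vector_mult_basis using kI by (auto simp: column_def vec_eq_iff block_outside axis_def)
  have kA: "(?A *v x) $ k = x $ k" for x
    using kI by (simp add: matrix_vector_mult_def block_outside)
  let ?x = "axis k 1 - c"
  have xk: "?x $ k = 1" by (simp add: ck)
  then have "?x \<noteq> 0" by (metis zero_index zero_neq_one)
  then have "0 < ?x \<bullet> (block (insert k I) w *v ?x)" using assms by (simp add: pos_def_def)
  then have "0 < ?x \<bullet> (?A *v ?x) + (g + c \<bullet> (block1 I v *v c) - 1) + 2 * (?x \<bullet> (block1 I v *v c))"
    unfolding block_insert_form xk by simp
  moreover have "?x \<bullet> (?A *v ?x) = c \<bullet> (?A *v c) + 1"
    by (simp add: matrix_vector_mult_diff_distrib Ak kA inner_diff_left inner_diff_right inner_axis inner_axis' ck)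
  moreover have "?x \<bullet> (block1 I v *v c) = - (c \<bullet> (block1 I v *v c))"
    using kI by (simp add: inner_diff_left inner_axis' Mck)
  moreover have "c \<bullet> (block1 I v *v c) = c \<bullet> (?A *v c) + (\<Sum>i\<in>I. (c$i)\<^sup>2)"
    by (simp add: block1_quadratic_form power2_eq_square)
  ultimately show ?thesis by simp
qed

end

lemma block_insert_integrand_le:
  fixes I :: "'n::{finite,linorder} set" and v w :: "'n \<times> 'n \<Rightarrow> real" and c :: "real^'n::{finite,linorder}"
  assumes k: "\<And>i. i \<in> I \<Longrightarrow> i < k" and c: "\<And>i. i \<notin> I \<Longrightarrow> c $ i = 0"
    and w: "\<And>p. p \<in> block_idx I \<Longrightarrow> w p = v p"
    and wk: "\<And>i. i \<in> I \<Longrightarrow> w (i, k) = (block1 I v *v c) $ i"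
    and wkk: "w (k, k) = g + c \<bullet> (block1 I v *v c)"
    and pd: "pos_def (block (insert k I) w)"
  shows "0 < g"
    and "det (block1 (insert k I) w) powr (- (real (card (insert k I)) + 1/2)) \<le>
      det (block1 I v) powr (- (real (card I) + 3/2)) * (1 + g) powr (-3/2) * (\<Prod>i\<in>I. inverse (1 + (c$i)\<^sup>2))"
proof -
  have gap: "(\<Sum>i\<in>I. (c$i)\<^sup>2) < g" by (rule pos_def_block_insert_gap[OF k c w wk wkk pd])
  then show g: "0 < g" by (smt (verit) sum_nonneg zero_le_power2)
  have kI: "k \<notin> I" using k by blast
  have "det (block1 (insert k I) w) = det (block1 I v) * (1 + g)"
    by (rule det_block1_insert[OF k c w wk wkk])
  moreover have "0 < det (block1 I v)"
    using pos_def_det_pos[OF pos_def_block1[OF pos_def_block_insert_imp[OF kI w pd]]] .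
  moreover have "(1 + g) powr (- (real (card I) + 3/2)) \<le> (1 + g) powr (-3/2) * (\<Prod>i\<in>I. inverse (1 + (c$i)\<^sup>2))"
  proof -
    \<comment> \<open>Every single square is below |c|^2 < \<open>g\<close>, so one factor
      \<open>1 + g\<close> pays for each Cauchy factor.\<close>
    have "(\<Prod>i\<in>I. 1 + (c$i)\<^sup>2) \<le> (\<Prod>i\<in>I. 1 + g)"
    proof (rule prod_mono)
      fix i assume "i \<in> I"
      then have "(c$i)\<^sup>2 \<le> (\<Sum>i\<in>I. (c$i)\<^sup>2)" by (intro member_le_sum) auto
      with gap show "0 \<le> 1 + (c$i)\<^sup>2 \<and> 1 + (c$i)\<^sup>2 \<le> 1 + g" by simp
    qed
    then have "inverse ((1 + g) ^ card I) \<le> inverse (\<Prod>i\<in>I. 1 + (c$i)\<^sup>2)"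
      by (intro le_imp_inverse_le prod_pos) (auto intro: add_pos_nonneg)
    then have "(1 + g) powr (-3/2) * inverse ((1 + g) ^ card I) \<le> (1 + g) powr (-3/2) * (\<Prod>i\<in>I. inverse (1 + (c$i)\<^sup>2))"
      by (intro mult_left_mono) (auto simp: prod_inversef[unfolded o_def])
    moreover have "(1 + g) powr (- (real (card I) + 3/2)) = (1 + g) powr (-3/2) * inverse ((1 + g) ^ card I)"
    proof -
      have "(1 + g) powr (- (real (card I) + 3/2)) = (1 + g) powr (-3/2 + - real (card I))"
        by (rule arg_cong[where f="\<lambda>t. (1 + g) powr t"]) simp
      also have "\<dots> = (1 + g) powr (-3/2) * inverse ((1 + g) ^ card I)"
        using g by (simp only: powr_add powr_minus) (simp add: powr_realpow)
      finally show ?thesis .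
    qed
    ultimately show ?thesis by simp
  qed
  ultimately show "det (block1 (insert k I) w) powr (- (real (card (insert k I)) + 1/2)) \<le>
      det (block1 I v) powr (- (real (card I) + 3/2)) * (1 + g) powr (-3/2) * (\<Prod>i\<in>I. inverse (1 + (c$i)\<^sup>2))"
    using kI g by (simp add: powr_mult mult.assoc mult_left_mono add.commute)
qed

text \<open>Positivity is required of the block itself, while the power is of the shifted block. The
  exponent depends on \<open>card I\<close> so that the integrand for \<open>insert k I\<close>,
  after the Jacobian, is bounded by a multiple of the one for \<open>I\<close>.\<close>

definition block_integrand :: "'n::{finite,linorder} set \<Rightarrow> ('n \<times> 'n \<Rightarrow> real) \<Rightarrow> ennreal" where
  "block_integrand I v = indicator (Collect pos_def) (block I v) * ennreal (det (block1 I v) powr (- (real (card I) + 1/2)))"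

lemma block_integrand_measurable [measurable]: "block_integrand I \<in> borel_measurable (LP (block_idx I))"
  unfolding block_integrand_def[abs_def] by measurable

text \<open>The padded matrix acts as the identity off \<open>I\<close> and does not mix the two
  groups of coordinates, so its full determinant is the Jacobian of b = (1 + B) c on
  \<open>I\<close>.\<close>

lemma nn_integral_block1:
  fixes I :: "'n::{finite,linorder} set"
  assumes det: "det (block1 I v) \<noteq> 0" and G: "G \<in> borel_measurable (LP I)"
  shows "(\<integral>\<^sup>+b. G b \<partial>LP I) = ennreal \<bar>det (block1 I v)\<bar> *
     (\<integral>\<^sup>+c. G (\<lambda>i\<in>I. (block1 I v *v (\<chi> j. if j \<in> I then c j else 0)) $ i) \<partial>LP I)"
proof -
  have loc: "(block1 I v *v x) $ i = (block1 I v *v y) $ i" if "i \<in> I" "\<And>j. j \<in> I \<Longrightarrow> x$j = y$j" for x y i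
    unfolding matrix_vector_mult_def vec_lambda_beta
  proof (rule sum.cong[OF refl])
    fix j show "block1 I v $ i $ j * x $ j = block1 I v $ i $ j * y $ j"
      using that by (cases "j \<in> I") (auto simp: block1_outside)
  qed
  have "(\<integral>\<^sup>+b. G b \<partial>LP I) = ennreal \<bar>det (matrix ((*v) (block1 I v)))\<bar> *
     (\<integral>\<^sup>+c. G (\<lambda>i\<in>I. (block1 I v *v (\<chi> j. c j)) $ i) \<partial>LP I)"
  proof (rule nn_integral_PiM_linear[symmetric, OF matrix_vector_mul_linear _ _ _ G])
    show "det (matrix ((*v) (block1 I v))) \<noteq> 0" using det by simp
    show "(block1 I v *v x) $ i = x $ i" if "i \<notin> I" for x i using that by (rule block1_mult_outside)
    show "(block1 I v *v x) $ i = (block1 I v *v y) $ i" if "i \<in> I" "\<And>j. j \<in> I \<Longrightarrow> x$j = y$j" for x y i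
      using that by (rule loc)
  qed
  also have "(\<integral>\<^sup>+c. G (\<lambda>i\<in>I. (block1 I v *v (\<chi> j. c j)) $ i) \<partial>LP I) =
     (\<integral>\<^sup>+c. G (\<lambda>i\<in>I. (block1 I v *v (\<chi> j. if j \<in> I then c j else 0)) $ i) \<partial>LP I)"
    by (intro nn_integral_cong arg_cong[where f=G] restrict_ext, rule loc) auto
  finally show ?thesis by (simp only: matrix_of_matrix_vector_mul)
qed

lemma block_idx_insert:
  assumes "\<And>i. i \<in> I \<Longrightarrow> i < k"
  shows "block_idx (insert k I) = insert (k, k) (block_idx I \<union> (\<lambda>i. (i, k)) ` I)"
  using assms by (auto simp: block_idx_def less_imp_le dest: leD)

text \<open>Fubini over old block, border and corner, with the border indexed by \<open>I\<close> so
  that a matrix can act on it. The two measurability claims are what the substitutions in the border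
  and in the corner require.\<close>

lemma block_integral_insert:
  fixes I :: "'n::{finite,linorder} set"
  assumes less: "\<forall>i\<in>I. i < k"
  defines "R \<equiv> (\<lambda>i. (i, k)) ` I"
  shows "(\<integral>\<^sup>+v. block_integrand (insert k I) v \<partial>LP (block_idx (insert k I))) =
    (\<integral>\<^sup>+v. \<integral>\<^sup>+b. \<integral>\<^sup>+x. block_integrand (insert k I) ((merge (block_idx I) R (v, \<lambda>p\<in>R. b (fst p)))((k, k) := x)) \<partial>lborel \<partial>LP I \<partial>LP (block_idx I))"
    and "\<And>v. v \<in> space (LP (block_idx I)) \<Longrightarrow>
      (\<lambda>b. \<integral>\<^sup>+x. block_integrand (insert k I) ((merge (block_idx I) R (v, \<lambda>p\<in>R. b (fst p)))((k, k) := x)) \<partial>lborel) \<in> borel_measurable (LP I)"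
    and "\<And>v b. v \<in> space (LP (block_idx I)) \<Longrightarrow> b \<in> space (LP I) \<Longrightarrow>
      (\<lambda>x. block_integrand (insert k I) ((merge (block_idx I) R (v, \<lambda>p\<in>R. b (fst p)))((k, k) := x))) \<in> borel_measurable lborel"
proof -
  let ?U = "block_idx I"
  let ?F = "block_integrand (insert k I)"
  have k: "i < k" if "i \<in> I" for i using less that by blast
  then have kI: "k \<notin> I" by blast
  have idx: "block_idx (insert k I) = insert (k, k) (?U \<union> R)"
    unfolding R_def by (rule block_idx_insert[OF k])
  have dis: "?U \<inter> R = {}" "(k, k) \<notin> ?U \<union> R" using kI by (auto simp: block_idx_def R_def)
  have F: "?F \<in> borel_measurable (LP (insert (k, k) (?U \<union> R)))"
    using block_integrand_measurable[of "insert k I"] by (simp only: idx)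
  define g where "g w = (\<integral>\<^sup>+x. ?F (w((k, k) := x)) \<partial>lborel)" for w
  have [measurable]: "(\<lambda>(w, x). ?F (w((k, k) := x))) \<in> borel_measurable (LP (?U \<union> R) \<Otimes>\<^sub>M lborel)"
    using measurable_compose[OF measurable_add_dim F] by (simp add: case_prod_beta')
  have g: "g \<in> borel_measurable (LP (?U \<union> R))"
    unfolding g_def[abs_def] by (rule lborel.borel_measurable_nn_integral) fact
  have bij: "bij_betw fst R I" by (auto simp: bij_betw_def inj_on_def R_def image_image)
  have m1: "(\<lambda>y. merge ?U R (v, y)) \<in> LP R \<rightarrow>\<^sub>M LP (?U \<union> R)" if "v \<in> space (LP ?U)" for v
    using that by measurable
  have m2: "(\<lambda>b. \<lambda>p\<in>R. b (fst p)) \<in> LP I \<rightarrow>\<^sub>M LP R"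
    by (intro measurable_restrict measurable_component_singleton) (auto simp: R_def)
  note m12 = measurable_compose[OF m2 m1]
  show "(\<lambda>b. \<integral>\<^sup>+x. ?F ((merge ?U R (v, \<lambda>p\<in>R. b (fst p)))((k, k) := x)) \<partial>lborel) \<in> borel_measurable (LP I)"
    if "v \<in> space (LP ?U)" for v
    using measurable_compose[OF m12[OF that] g] by (simp add: g_def)
  show "(\<lambda>x. ?F ((merge ?U R (v, \<lambda>p\<in>R. b (fst p)))((k, k) := x))) \<in> borel_measurable lborel"
    if "v \<in> space (LP ?U)" "b \<in> space (LP I)" for v b
    using measurable_compose[OF measurable_component_update[OF measurable_space[OF m12[OF that(1)] that(2)] dis(2)] F] .
  have "(\<integral>\<^sup>+v. ?F v \<partial>LP (block_idx (insert k I))) = (\<integral>\<^sup>+w. g w \<partial>LP (?U \<union> R))"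
    unfolding idx g_def by (rule lborel_product.product_nn_integral_insert[OF _ dis(2) F]) simp
  also have "\<dots> = (\<integral>\<^sup>+v. \<integral>\<^sup>+y. g (merge ?U R (v, y)) \<partial>LP R \<partial>LP ?U)"
    by (rule lborel_product.product_nn_integral_fold[OF dis(1) _ _ g]) simp_all
  also have "\<dots> = (\<integral>\<^sup>+v. \<integral>\<^sup>+b. g (merge ?U R (v, \<lambda>p\<in>R. b (fst p))) \<partial>LP I \<partial>LP ?U)"
    by (intro nn_integral_cong nn_integral_PiM_reindex[OF _ bij, symmetric] measurable_compose[OF m1 g]) auto
  finally show "(\<integral>\<^sup>+v. ?F v \<partial>LP (block_idx (insert k I))) =
    (\<integral>\<^sup>+v. \<integral>\<^sup>+b. \<integral>\<^sup>+x. ?F ((merge ?U R (v, \<lambda>p\<in>R. b (fst p)))((k, k) := x)) \<partial>lborel \<partial>LP I \<partial>LP ?U)"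
    by (simp only: g_def)
qed

text \<open>The induction adjoins a new maximum each time, so that the new upper entries are exactly
  a column above a new corner.\<close>

lemma block_integral_finite:
  fixes I :: "'n::{finite,linorder} set"
  shows "(\<integral>\<^sup>+v. block_integrand I v \<partial>LP (block_idx I)) < \<infinity>"
proof (induction I rule: finite_linorder_max_induct[OF finite])
  \<comment> \<open>The empty block is the identity matrix, on a function space with a single
    point.\<close>
  case 1
  show ?case
    by (auto simp: block_integrand_def block_idx_def block_def block1_def space_PiM ennreal_mult_less_top split: split_indicator)
next
  case (2 k I)
  then have k: "\<And>i. i \<in> I \<Longrightarrow> i < k" and kI: "k \<notin> I" by auto
  define R where "R = (\<lambda>i. (i, k)) ` I"
  let ?U = "block_idx I"
  let ?F = "block_integrand (insert k I)"
  define comb where "comb v b = merge ?U R (v, \<lambda>p\<in>R. b (fst p))" for v :: "'n \<times> 'n \<Rightarrow> real" and b :: "'n \<Rightarrow> real"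
  define K1 where "K1 = (\<integral>\<^sup>+x. ennreal ((1 + x) powr (-3/2)) * indicator {0<..} x \<partial>lborel)"
  define K2 where "K2 = (\<integral>\<^sup>+x. ennreal (inverse (1 + x\<^sup>2)) \<partial>lborel)"
  have comb_U: "comb v b p = v p" if "p \<in> ?U" for v b p using that by (simp add: comb_def merge_def)
  have comb_R: "comb v b (i, k) = b i" if "i \<in> I" for v b i
    using that kI by (auto simp: comb_def merge_def R_def block_idx_def)
  have kkU: "(k, k) \<notin> ?U" using kI by (auto simp: block_idx_def)
  note ins = block_integral_insert[OF \<open>\<forall>i\<in>I. i < k\<close>, folded R_def, folded comb_def]
  have inner: "(\<integral>\<^sup>+b. \<integral>\<^sup>+x. ?F ((comb v b)((k, k) := x)) \<partial>lborel \<partial>LP I) \<le> K1 * K2 ^ card I * block_integrand I v"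
    if v: "v \<in> space (LP ?U)" for v
  proof (cases "pos_def (block I v)")
    case False
    have "((comb v b)((k, k) := x)) p = v p" if "p \<in> ?U" for b x p using that kkU comb_U by auto
    then have "\<not> pos_def (block (insert k I) ((comb v b)((k, k) := x)))" for b x
      using False pos_def_block_insert_imp[OF kI] by blast
    then show ?thesis by (simp add: block_integrand_def)
  next
    case True
    let ?M = "block1 I v"
    have M: "0 < det ?M" using pos_def_det_pos[OF pos_def_block1[OF True]] .
    define C where "C c = (\<chi> j. if j \<in> I then c j else 0)" for c :: "'n \<Rightarrow> real"
    define B where "B c = (\<lambda>i\<in>I. (?M *v C c) $ i)" for c
    let ?d = "ennreal (det ?M powr (- (real (card I) + 3/2)))"
    let ?P = "\<lambda>c. \<Prod>i\<in>I. ennreal (inverse (1 + (c i)\<^sup>2))"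
    have step: "(\<integral>\<^sup>+x. ?F ((comb v (B c))((k, k) := x)) \<partial>lborel) \<le> ?d * K1 * ?P c" for c
    proof -
      \<comment> \<open>Translating the corner by \<open>?t\<close> makes the Schur gap
        \<open>g\<close> the variable of integration.\<close>
      let ?t = "C c \<bullet> (?M *v C c)"
      have "B c \<in> space (LP I)" by (auto simp: B_def space_PiM)
      then have "(\<integral>\<^sup>+x. ?F ((comb v (B c))((k, k) := x)) \<partial>lborel) = (\<integral>\<^sup>+g. ?F ((comb v (B c))((k, k) := ?t + g)) \<partial>lborel)"
        using nn_integral_real_affine[of "\<lambda>x. ?F ((comb v (B c))((k, k) := x))" 1 ?t] ins(3)[OF v] by simp
      also have "\<dots> \<le> (\<integral>\<^sup>+g. (?d * ?P c) * (ennreal ((1 + g) powr (-3/2)) * indicator {0<..} g) \<partial>lborel)"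
      proof (intro nn_integral_mono)
        fix g
        let ?w = "(comb v (B c))((k, k) := ?t + g)"
        show "?F ?w \<le> (?d * ?P c) * (ennreal ((1 + g) powr (-3/2)) * indicator {0<..} g)"
        proof (cases "pos_def (block (insert k I) ?w)")
          case True
          have c0: "C c $ i = 0" if "i \<notin> I" for i using that by (simp add: C_def)
          have w: "?w p = v p" if "p \<in> ?U" for p using that kkU comb_U by auto
          have wk: "?w (i, k) = (?M *v C c) $ i" if "i \<in> I" for i
            using that kI comb_R[OF that, of v "B c"] by (auto simp: B_def)
          have wkk: "?w (k, k) = g + ?t" by simp
          note le = block_insert_integrand_le[OF k c0 w wk wkk True]
          have "?F ?w \<le> ennreal (det ?M powr (- (real (card I) + 3/2)) * (1 + g) powr (-3/2) * (\<Prod>i\<in>I. inverse (1 + (C c $ i)\<^sup>2)))"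
            using le(2) True unfolding block_integrand_def by (simp add: ennreal_leI)
          also have "(\<Prod>i\<in>I. inverse (1 + (C c $ i)\<^sup>2)) = (\<Prod>i\<in>I. inverse (1 + (c i)\<^sup>2))"
            by (intro prod.cong) (auto simp: C_def)
          also have "ennreal (det ?M powr (- (real (card I) + 3/2)) * (1 + g) powr (-3/2) * (\<Prod>i\<in>I. inverse (1 + (c i)\<^sup>2))) =
             ?d * ennreal ((1 + g) powr (-3/2)) * ?P c"
            by (simp add: ennreal_mult prod_nonneg prod_ennreal)
          also have "\<dots> = (?d * ?P c) * (ennreal ((1 + g) powr (-3/2)) * indicator {0<..} g)"
            using le(1) by (simp add: mult_ac)
          finally show ?thesis .
        qed (simp add: block_integrand_def)
      qed
      also have "\<dots> = (?d * ?P c) * K1" unfolding K1_def by (rule nn_integral_cmult) measurable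
      finally show ?thesis by (simp add: mult_ac)
    qed
    have "(\<integral>\<^sup>+b. \<integral>\<^sup>+x. ?F ((comb v b)((k, k) := x)) \<partial>lborel \<partial>LP I) =
        ennreal \<bar>det ?M\<bar> * (\<integral>\<^sup>+c. \<integral>\<^sup>+x. ?F ((comb v (B c))((k, k) := x)) \<partial>lborel \<partial>LP I)"
      unfolding B_def C_def by (rule nn_integral_block1[OF _ ins(2)[OF v]]) (use M in simp)
    also have "\<dots> \<le> ennreal \<bar>det ?M\<bar> * (\<integral>\<^sup>+c. ?d * K1 * ?P c \<partial>LP I)"
      by (intro mult_left_mono nn_integral_mono step) simp
    also have "(\<integral>\<^sup>+c. ?d * K1 * ?P c \<partial>LP I) = ?d * K1 * (\<integral>\<^sup>+c. ?P c \<partial>LP I)"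
      by (rule nn_integral_cmult) measurable
    also have "(\<integral>\<^sup>+c. ?P c \<partial>LP I) = K2 ^ card I"
      unfolding K2_def by (subst lborel_product.product_nn_integral_prod) simp_all
    also have "ennreal \<bar>det ?M\<bar> * (?d * K1 * K2 ^ card I) = K1 * K2 ^ card I * (ennreal \<bar>det ?M\<bar> * ?d)"
      by (simp add: mult_ac)
    \<comment> \<open>The Jacobian takes one power off the exponent \<open>card I + 3/2\<close>,
      which restores the integrand of the smaller block.\<close>
    also have "ennreal \<bar>det ?M\<bar> * ?d = ennreal (det ?M powr (- (real (card I) + 1/2)))"
    proof -
      have "\<bar>det ?M\<bar> * det ?M powr (- (real (card I) + 3/2)) = det ?M powr (1 + - (real (card I) + 3/2))"
        unfolding powr_add using M by simp
      also have "1 + - (real (card I) + 3/2) = - (real (card I) + 1/2)" by simp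
      finally show ?thesis by (simp only: ennreal_mult[symmetric] abs_ge_zero powr_ge_zero)
    qed
    also have "\<dots> = block_integrand I v" using True by (simp add: block_integrand_def)
    finally show ?thesis .
  qed
  have "(\<integral>\<^sup>+v. ?F v \<partial>LP (block_idx (insert k I))) = (\<integral>\<^sup>+v. \<integral>\<^sup>+b. \<integral>\<^sup>+x. ?F ((comb v b)((k, k) := x)) \<partial>lborel \<partial>LP I \<partial>LP ?U)"
    by (rule ins(1))
  also have "\<dots> \<le> (\<integral>\<^sup>+v. K1 * K2 ^ card I * block_integrand I v \<partial>LP ?U)"
    by (intro nn_integral_mono inner)
  also have "\<dots> = K1 * K2 ^ card I * (\<integral>\<^sup>+v. block_integrand I v \<partial>LP ?U)"
    by (rule nn_integral_cmult) measurable
  also have "\<dots> < \<infinity>"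
    using 2 nn_integral_powr_tail_finite nn_integral_inverse_1_plus_sq_finite
    by (auto simp: K1_def K2_def ennreal_mult_less_top power_less_top_ennreal)
  finally show ?case .
qed

section \<open>The normalising constant and the density\<close>

text \<open>With X the inverse of B, the ratio det X / det (1 + X) is the inverse of det (1 + B).
  The power s = p + 1/2 of this ratio is split off; what remains is polynomially bounded in tr X and
  is absorbed by the exponential.\<close>

lemma cint_le:
  assumes "1 \<le> q" and a: "real CARD('n::{finite,linorder}) + 1/2 \<le> a"
  obtains C where "0 \<le> C" "\<And>B :: real^'n::{finite,linorder}^'n::{finite,linorder}. pos_def B \<Longrightarrow>
     exp (- trace (mpow (matrix_inv B) q) / 2) * det B powr (- a) \<le> C * det (B + mat 1) powr (- (real CARD('n) + 1/2))"
proof -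
  let ?p = "real CARD('n)"
  have p: "1 \<le> ?p" by (simp add: Suc_leI)
  \<comment> \<open>Chosen so that exp (t / n) to the power p a equals exp (t / 2), which cancels
    exp (- t / 2).\<close>
  define n where "n = 2 * ?p * a"
  have a1: "1 \<le> a" using p a by linarith
  have "2 * 1 * 1 \<le> n" unfolding n_def using p a1 by (intro mult_mono) auto
  then have n: "1 \<le> n" by simp
  define C where "C = exp (real q * ?p / 2) * (fact CARD('n)) powr a * n powr (?p * a)"
  have "exp (- trace (mpow (matrix_inv B) q) / 2) * det B powr (- a) \<le> C * det (B + mat 1) powr (- (?p + 1/2))"
    if B: "pos_def B" for B :: "real^'n::_^'n::_"
  proof -
    define X where "X = matrix_inv B"
    define t where "t = trace X"
    \<comment> \<open>One bound for both determinants, since the entries of X and of 1 + X are at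
      most 1 + t in absolute value. It makes K^(a - s) K^s collapse to K^a.\<close>
    define K where "K = fact CARD('n) * (1 + t) ^ CARD('n)"
    have BX: "B ** X = mat 1" unfolding X_def by (rule matrix_inv[OF pos_def_invertible[OF B]])
    have X: "pos_def X" unfolding X_def by (rule pos_def_matrix_inv[OF B])
    then have psdX: "psd X" by (rule pos_def_imp_psd)
    have t: "0 \<le> t" unfolding t_def by (rule trace_psd_nonneg[OF psdX])
    have entry: "\<bar>X$i$j\<bar> \<le> t" for i j unfolding t_def by (rule psd_abs_entry_le_trace[OF psdX])
    have detX: "0 < det X" by (rule pos_def_det_pos[OF X])
    have detB: "det B = inverse (det X)"
      using BX by (metis det_I det_mul inverse_unique mult.commute)
    have "pos_def (mat 1 + X)"
    proof -
      have "transpose (mat 1 + X) = mat 1 + transpose X" by (simp add: transpose_def vec_eq_iff mat_def)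
      moreover have "x \<bullet> ((mat 1 + X) *v x) = x \<bullet> x + x \<bullet> (X *v x)" for x
        by (simp add: matrix_vector_mult_add_rdistrib inner_add_right)
      ultimately show ?thesis using X by (simp add: pos_def_def add_pos_pos)
    qed
    then have det1X: "0 < det (mat 1 + X)" by (rule pos_def_det_pos)
    have "\<bar>det X\<bar> \<le> K" unfolding K_def
    proof (rule abs_det_le)
      fix i j show "\<bar>X $ i $ j\<bar> \<le> 1 + t"
        using entry[of i j] by simp
    qed
    moreover have "\<bar>det (mat 1 + X)\<bar> \<le> K" unfolding K_def
    proof (rule abs_det_le)
      fix i j show "\<bar>(mat 1 + X) $ i $ j\<bar> \<le> 1 + t"
        using entry[of i j] t by (auto simp: mat_def)
    qed
    ultimately have K: "det X \<le> K" "det (mat 1 + X) \<le> K" by auto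
    have "B + mat 1 = B ** (mat 1 + X)" by (simp add: matrix_add_ldistrib BX add.commute)
    then have detB1: "det (B + mat 1) = det (mat 1 + X) / det X"
      by (simp add: det_mul detB field_simps)
    define s where "s = ?p + 1/2"
    have tr: "t - real q * ?p \<le> trace (mpow X q)"
    proof -
      have "t * 1 \<le> t * real q" using assms(1) t by (intro mult_left_mono) auto
      then show ?thesis using trace_mpow_ge[OF psdX, of q] p by (simp add: t_def algebra_simps)
    qed
    have e1: "exp (- trace (mpow X q) / 2) \<le> exp (real q * ?p / 2) * exp (- t / 2)"
      unfolding exp_add[symmetric] using tr by simp
    have "1 + t \<le> n * exp (t / n)"
    proof -
      have "1 + t \<le> n * (1 + t / n)" using n t by (simp add: field_simps)
      also have "\<dots> \<le> n * exp (t / n)" using n by (intro mult_left_mono exp_ge_add_one_self) auto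
      finally show ?thesis .
    qed
    then have "(1 + t) powr (?p * a) \<le> (n * exp (t / n)) powr (?p * a)"
      using t p a by (intro powr_mono2) auto
    also have "\<dots> = n powr (?p * a) * exp (t / n) powr (?p * a)"
      using n by (simp add: powr_mult)
    also have "exp (t / n) powr (?p * a) = exp (?p * a * (t / n))" by (simp add: powr_def)
    also have "?p * a * (t / n) = t / 2" using p a1 by (simp add: n_def)
    finally have e2: "(1 + t) powr (?p * a) \<le> n powr (?p * a) * exp (t / 2)" .
    have "(1 + t) ^ CARD('n) = (1 + t) powr ?p" using t by (subst powr_realpow) auto
    then have "K powr a = fact CARD('n) powr a * (1 + t) powr (?p * a)"
      using t by (simp only: K_def powr_mult powr_powr)
    also have "\<dots> \<le> fact CARD('n) powr a * (n powr (?p * a) * exp (t / 2))"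
      by (intro mult_left_mono e2) auto
    finally have e3: "K powr a \<le> fact CARD('n) powr a * (n powr (?p * a) * exp (t / 2))" .
    have "det X powr (a - s) * det (mat 1 + X) powr s \<le> K powr (a - s) * K powr s"
      using K detX det1X a by (intro mult_mono powr_mono2) (auto simp: s_def)
    also have "\<dots> = K powr a" by (simp flip: powr_add)
    finally have e4: "det X powr (a - s) * det (mat 1 + X) powr s \<le> fact CARD('n) powr a * (n powr (?p * a) * exp (t / 2))"
      using e3 by linarith
    have "exp (- trace (mpow X q) / 2) * (det X powr (a - s) * det (mat 1 + X) powr s) \<le>
        (exp (real q * ?p / 2) * exp (- t / 2)) * (fact CARD('n) powr a * (n powr (?p * a) * exp (t / 2)))"
      by (rule mult_mono[OF e1 e4]) auto
    also have "\<dots> = C" by (simp add: C_def exp_minus field_simps)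
    finally have main: "exp (- trace (mpow X q) / 2) * (det X powr (a - s) * det (mat 1 + X) powr s) \<le> C" .
    have "det B powr (- a) = det X powr a" using detX by (simp add: detB powr_minus inverse_powr)
    \<comment> \<open>The factor det (1 + X)^s is inserted and cancelled. The first bracket is the
      polynomially growing part, and the second becomes det (B + 1)^(-s).\<close>
    also have "\<dots> = (det X powr (a - s) * det (mat 1 + X) powr s) * (det X powr s * det (mat 1 + X) powr (- s))"
    proof -
      have "(det X powr (a - s) * det (mat 1 + X) powr s) * (det X powr s * det (mat 1 + X) powr (- s)) =
        (det X powr (a - s) * det X powr s) * (det (mat 1 + X) powr s * det (mat 1 + X) powr (- s))"
        by (simp only: mult_ac)
      moreover have "det X powr (a - s) * det X powr s = det X powr a" by (simp flip: powr_add)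
      moreover have "det (mat 1 + X) powr s * det (mat 1 + X) powr (- s) = 1"
        using det1X by (simp flip: powr_add)
      ultimately show ?thesis by (simp only: mult_1_right)
    qed
    also have "det X powr s * det (mat 1 + X) powr (- s) = det (B + mat 1) powr (- s)"
      using detX det1X unfolding detB1 by (simp add: powr_minus powr_divide field_simps)
    finally have "exp (- trace (mpow X q) / 2) * det B powr (- a) =
       (exp (- trace (mpow X q) / 2) * (det X powr (a - s) * det (mat 1 + X) powr s)) * det (B + mat 1) powr (- s)"
      by (simp add: mult.assoc)
    also have "\<dots> \<le> C * det (B + mat 1) powr (- s)"
      by (intro mult_right_mono main) auto
    finally show ?thesis unfolding X_def s_def .
  qed
  then show thesis using that[of C] by (simp add: C_def)
qed

lemma block_idx_UNIV: "block_idx UNIV = upper_idx"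
  by (simp add: block_idx_def upper_idx_def)

lemma block_UNIV: "block UNIV v = sym_of v"
  by (simp add: block_def sym_of_def)

lemma block1_UNIV: "block1 UNIV v = sym_of v + mat 1"
  by (simp add: block1_def block_UNIV mat_def vec_eq_iff)

lemma sym_of_measurable [measurable]: "sym_of \<in> borel_measurable (LP upper_idx)"
  using block_measurable[of UNIV] by (simp add: block_idx_UNIV block_UNIV[abs_def])

lemma PD_set_iff: "v \<in> PD_set \<longleftrightarrow> v \<in> space (LP upper_idx) \<and> pos_def (sym_of v)"
  by (simp add: PD_set_def sym_lebesgue_def)

section \<open>Measurability of the integrand\<close>

lemma borel_measurable_matrix_nth:
  fixes f :: "'a \<Rightarrow> real^'m^'n"
  assumes "f \<in> borel_measurable M"
  shows "(\<lambda>x. f x $ i $ j) \<in> borel_measurable M"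
proof -
  have "(\<lambda>A :: real^'m^'n. A $ i $ j) \<in> borel_measurable borel"
    by (intro borel_measurable_continuous_onI continuous_intros)
  from measurable_compose[OF assms this] show ?thesis .
qed

lemma borel_measurable_matrix_mult:
  fixes f :: "'a \<Rightarrow> real^'m^'n" and g :: "'a \<Rightarrow> real^'k^'m"
  assumes "f \<in> borel_measurable M" "g \<in> borel_measurable M"
  shows "(\<lambda>x. f x ** g x) \<in> borel_measurable M"
  by (rule borel_measurable_matrix)
     (simp add: matrix_matrix_mult_def borel_measurable_sum borel_measurable_times borel_measurable_matrix_nth assms)

text \<open>Cramer's rule as an explicit rational formula: its measurability is visible, whereas
  \<open>matrix_inv\<close> is defined by choice. The two agree where the determinant is
  nonzero.\<close>

definition cramer_inv :: "real^'n^'n \<Rightarrow> real^'n^'n" where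
  "cramer_inv A = (\<chi> i j. det (\<chi> k l. if l = i then of_bool (k = j) else A$k$l) / det A)"

lemma matrix_inv_eq_cramer_inv:
  assumes "det A \<noteq> 0"
  shows "matrix_inv A = cramer_inv A"
proof -
  have "A ** matrix_inv A = mat 1" using assms by (intro matrix_inv) (simp add: invertible_det_nz)
  have "matrix_inv A *v axis j 1 = (\<chi> k. det (\<chi> i l. if l = k then axis j 1 $ i else A$i$l) / det A)" for j
    using cramer[OF assms, of "matrix_inv A *v axis j 1" "axis j 1"] \<open>A ** matrix_inv A = mat 1\<close>
    by (simp add: matrix_vector_mul_assoc)
  note col = this
  have "matrix_inv A $ i $ j = det (\<chi> k l. if l = i then of_bool (k = j) else A$k$l) / det A" for i j
  proof -
    have "matrix_inv A $ i $ j = (matrix_inv A *v axis j 1) $ i"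
      by (simp only: matrix_vector_mult_basis) (simp add: column_def)
    moreover have "axis j 1 $ k = (of_bool (k = j) :: real)" for k by (simp add: axis_def)
    ultimately show ?thesis by (simp only: col vec_lambda_beta)
  qed
  then show ?thesis by (simp add: cramer_inv_def vec_eq_iff)
qed

lemma cramer_inv_measurable: "(cramer_inv :: real^'n^'n \<Rightarrow> real^'n^'n) \<in> borel_measurable borel"
proof (rule borel_measurable_matrix)
  fix i j :: 'n
  have "(\<lambda>A :: real^'n^'n. (\<chi> k l. if l = i then of_bool (k = j) else A$k$l) :: real^'n^'n) \<in> borel_measurable borel"
  proof (rule borel_measurable_matrix)
    fix k l show "(\<lambda>A :: real^'n^'n. ((\<chi> k l. if l = i then of_bool (k = j) else A$k$l) :: real^'n^'n) $ k $ l) \<in> borel_measurable borel"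
      by (cases "l = i") (auto simp: borel_measurable_matrix_nth)
  qed
  from measurable_compose[OF this borel_measurable_det]
  show "(\<lambda>A :: real^'n^'n. cramer_inv A $ i $ j) \<in> borel_measurable borel"
    by (simp add: cramer_inv_def)
qed

lemma trace_mpow_measurable:
  fixes f :: "'a \<Rightarrow> real^'n::{finite,linorder}^'n::{finite,linorder}"
  assumes "f \<in> borel_measurable M"
  shows "(\<lambda>x. trace (mpow (f x) q)) \<in> borel_measurable M"
proof -
  have "(\<lambda>x. mpow (f x) q) \<in> borel_measurable M"
    by (induction q) (auto intro: borel_measurable_matrix_mult assms)
  then show ?thesis unfolding trace_def by (intro borel_measurable_sum borel_measurable_matrix_nth)
qed

text \<open>The indicator is built in because on \<open>PD_set\<close> the matrix is nonsingular and
  \<open>cramer_inv\<close> may replace \<open>matrix_inv\<close>.\<close>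

definition cint_PD :: "real \<Rightarrow> nat \<Rightarrow> ('n::{finite,linorder} \<times> 'n \<Rightarrow> real) \<Rightarrow> real" where
  "cint_PD m q v = cint m q v * indicator PD_set v"

lemma cint_PD_measurable:
  "cint_PD m q \<in> borel_measurable (LP (upper_idx :: ('n::{finite,linorder} \<times> 'n) set))"
proof -
  define h :: "real^'n::_^'n::_ \<Rightarrow> real" where
    "h A = exp (- trace (mpow (cramer_inv A) q) / 2) * det A powr (- (real q * m / 2) - real CARD('n) / 2 - 1 / 2) * indicator (Collect pos_def) A" for A
  have [measurable]: "(\<lambda>A. trace (mpow (cramer_inv A) q)) \<in> borel_measurable (borel :: (real^'n::_^'n::_) measure)"
    by (rule trace_mpow_measurable[OF cramer_inv_measurable])
  have "h \<in> borel_measurable borel" unfolding h_def[abs_def] by measurable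
  then have "(\<lambda>v. h (sym_of v)) \<in> borel_measurable (LP upper_idx)" by measurable
  moreover have "cint_PD m q v = h (sym_of v)" if "v \<in> space (LP upper_idx)" for v
  proof (cases "pos_def (sym_of v)")
    case True
    then have "matrix_inv (sym_of v) = cramer_inv (sym_of v)"
      using pos_def_det_pos[OF True] by (intro matrix_inv_eq_cramer_inv) simp
    then show ?thesis using True that by (simp add: cint_PD_def cint_def h_def PD_set_iff)
  qed (simp add: cint_PD_def h_def PD_set_iff)
  ultimately show ?thesis by (simp cong: measurable_cong)
qed

lemma cmq_eq: "cmq m q TYPE('n::{finite,linorder}) = (\<integral>\<^sup>+v. ennreal (cint_PD m q v) \<partial>LP (upper_idx :: ('n \<times> 'n) set))"
  unfolding cmq_def sym_lebesgue_def cint_PD_def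
  by (intro nn_integral_cong) (simp split: split_indicator)

lemma cmq_finite:
  assumes m: "real CARD('n::{finite,linorder}) \<le> m" and q: "1 \<le> q"
  shows "cmq m q TYPE('n) < \<infinity>"
proof -
  let ?a = "real q * m / 2 + real CARD('n) / 2 + 1 / 2"
  \<comment> \<open>Here m >= p and q >= 1 enter: qm/2 >= p/2 brings the exponent up to p +
    1/2.\<close>
  have "1 * m \<le> real q * m" using m q by (intro mult_right_mono) auto
  then have "real CARD('n) + 1/2 \<le> ?a" using m by simp
  from cint_le[OF q this] obtain C where C: "0 \<le> C" "\<And>B :: real^'n::_^'n::_. pos_def B \<Longrightarrow>
     exp (- trace (mpow (matrix_inv B) q) / 2) * det B powr (- ?a) \<le> C * det (B + mat 1) powr (- (real CARD('n) + 1/2))"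
    by blast
  have le: "ennreal (cint_PD m q v) \<le> ennreal C * block_integrand UNIV v" for v :: "'n \<times> 'n \<Rightarrow> real"
  proof (cases "v \<in> PD_set")
    case True
    then have pd: "pos_def (sym_of v)" by (simp add: PD_set_iff)
    have "- (real q * m / 2) - real CARD('n) / 2 - 1 / 2 = - ?a" by simp
    then have "cint_PD m q v = exp (- trace (mpow (matrix_inv (sym_of v)) q) / 2) * det (sym_of v) powr (- ?a)"
      using True by (simp only: cint_PD_def cint_def indicator_simps mult_1_right)
    also have "\<dots> \<le> C * det (sym_of v + mat 1) powr (- (real CARD('n) + 1/2))" by (rule C(2)[OF pd])
    finally show ?thesis
      using pd C(1) by (simp add: block_integrand_def block_UNIV block1_UNIV ennreal_leI flip: ennreal_mult)
  qed (simp add: cint_PD_def)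
  have "cmq m q TYPE('n) \<le> (\<integral>\<^sup>+v. ennreal C * block_integrand UNIV v \<partial>LP (upper_idx :: ('n \<times> 'n) set))"
    unfolding cmq_eq by (intro nn_integral_mono le)
  also have "\<dots> = ennreal C * (\<integral>\<^sup>+v. block_integrand UNIV v \<partial>LP (upper_idx :: ('n \<times> 'n) set))"
    using block_integrand_measurable[of "UNIV :: 'n set"] by (intro nn_integral_cmult) (simp add: block_idx_UNIV)
  also have "\<dots> < \<infinity>"
    using block_integral_finite[of "UNIV :: 'n set"] by (simp add: block_idx_UNIV ennreal_mult_less_top)
  finally show ?thesis .
qed

text \<open>Estimating each mixed term by half the sum of two squares costs p |x|^2 once the
  diagonal is included, against (p + 1) |x|^2 on the diagonal. The difference is exactly
  |x|^2.\<close>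

lemma pos_def_sym_of_diagonally_dominant:
  fixes v :: "'n::{finite,linorder} \<times> 'n \<Rightarrow> real"
  assumes d: "\<And>i. real CARD('n) \<le> v (i, i)" and o: "\<And>i j. i < j \<Longrightarrow> \<bar>v (i, j)\<bar> \<le> 1"
  shows "pos_def (sym_of v)"
  unfolding pos_def_def
proof (intro conjI allI impI transpose_sym_of)
  fix x :: "real^'n::_" assume x: "x \<noteq> 0"
  let ?N = "real CARD('n)"
  have entry: "(if j = i then (?N + 1) * (x$i)\<^sup>2 else 0) - ((x$i)\<^sup>2 + (x$j)\<^sup>2) / 2 \<le> x$i * (sym_of v $ i $ j * x$j)" for i j
  proof (cases "i = j")
    case True
    have "?N * (x$i)\<^sup>2 \<le> v (i, i) * (x$i)\<^sup>2" by (intro mult_right_mono d) auto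
    with True show ?thesis by (simp add: sym_of_nth power2_eq_square algebra_simps)
  next
    case False
    then have "min i j < max i j" by (auto simp: min_def max_def)
    then have b: "\<bar>sym_of v $ i $ j\<bar> \<le> 1" by (simp add: sym_of_nth o)
    have "\<bar>x$i * (sym_of v $ i $ j * x$j)\<bar> = \<bar>sym_of v $ i $ j\<bar> * (\<bar>x$i\<bar> * \<bar>x$j\<bar>)" by (simp add: abs_mult)
    also have "\<dots> \<le> 1 * (\<bar>x$i\<bar> * \<bar>x$j\<bar>)" by (intro mult_right_mono b) auto
    also have "\<dots> \<le> ((x$i)\<^sup>2 + (x$j)\<^sup>2) / 2"
      using sum_squares_bound[of "\<bar>x$i\<bar>" "\<bar>x$j\<bar>"] by simp
    finally have "- (x$i * (sym_of v $ i $ j * x$j)) \<le> ((x$i)\<^sup>2 + (x$j)\<^sup>2) / 2" by (rule abs_le_D2)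
    then have "- (((x$i)\<^sup>2 + (x$j)\<^sup>2) / 2) \<le> x$i * (sym_of v $ i $ j * x$j)" by linarith
    then show ?thesis using False by simp
  qed
  have "x \<bullet> x = (\<Sum>i\<in>UNIV. \<Sum>j\<in>UNIV. (if j = i then (?N + 1) * (x$i)\<^sup>2 else 0) - ((x$i)\<^sup>2 + (x$j)\<^sup>2) / 2)"
  proof -
    have S: "x \<bullet> x = (\<Sum>i\<in>UNIV. (x$i)\<^sup>2)" by (simp add: inner_vec_def power2_eq_square)
    have inner: "(\<Sum>j\<in>UNIV. (if j = i then (?N + 1) * (x$i)\<^sup>2 else 0) - ((x$i)\<^sup>2 + (x$j)\<^sup>2) / 2) =
        (?N + 1) * (x$i)\<^sup>2 - (?N * (x$i)\<^sup>2 + x \<bullet> x) / 2" for i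
      by (simp add: sum_subtractf sum.distrib S flip: sum_divide_distrib)
    have outer: "(\<Sum>i\<in>UNIV. (?N + 1) * (x$i)\<^sup>2 - (?N * (x$i)\<^sup>2 + x \<bullet> x) / 2) =
        (?N + 1) * (x \<bullet> x) - (?N * (x \<bullet> x) + ?N * (x \<bullet> x)) / 2"
      by (simp add: sum_subtractf sum.distrib S flip: sum_divide_distrib sum_distrib_left)
    show ?thesis unfolding inner outer by (simp add: algebra_simps)
  qed
  also have "\<dots> \<le> (\<Sum>i\<in>UNIV. \<Sum>j\<in>UNIV. x$i * (sym_of v $ i $ j * x$j))"
    by (intro sum_mono entry)
  also have "\<dots> = x \<bullet> (sym_of v *v x)" by (simp add: inner_vec_def matrix_vector_mult_def sum_distrib_left)
  finally show "0 < x \<bullet> (sym_of v *v x)" using x by (meson inner_gt_zero_iff less_le_trans)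
qed

text \<open>The integrand is strictly positive on the cone, and the cone contains a box of measure
  1: diagonal entries between p and p + 1, the others between 0 and 1, which is diagonally
  dominant.\<close>

lemma cmq_pos: "0 < cmq m q TYPE('n::{finite,linorder})"
proof (rule ccontr)
  assume "\<not> 0 < cmq m q TYPE('n)"
  then have "(\<integral>\<^sup>+v. ennreal (cint_PD m q v) \<partial>LP (upper_idx :: ('n \<times> 'n) set)) = 0" by (simp add: cmq_eq)
  then have null: "emeasure (LP upper_idx) {v \<in> space (LP (upper_idx :: ('n \<times> 'n) set)). ennreal (cint_PD m q v) \<noteq> 0} = 0"
    using measurable_compose[OF cint_PD_measurable measurable_ennreal] by (subst (asm) nn_integral_0_iff) auto
  define A where "A p = (if fst p = snd p then {real CARD('n)<..<real CARD('n) + 1} else {0<..<1})" for p :: "'n \<times> 'n"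
  have A: "A p \<in> sets lborel" "emeasure lborel (A p) = 1" for p by (auto simp: A_def)
  have "Pi\<^sub>E upper_idx A \<subseteq> {v \<in> space (LP upper_idx). ennreal (cint_PD m q v) \<noteq> 0}"
  proof
    fix v assume v: "v \<in> Pi\<^sub>E upper_idx A"
    then have sp: "v \<in> space (LP upper_idx)" by (auto simp: space_PiM PiE_iff)
    have vA: "v (i, j) \<in> A (i, j)" if "i \<le> j" for i j using v that by (auto simp: upper_idx_def)
    have "pos_def (sym_of v)"
    proof (rule pos_def_sym_of_diagonally_dominant)
      show "real CARD('n) \<le> v (i, i)" for i using vA[of i i] by (simp add: A_def)
      show "\<bar>v (i, j)\<bar> \<le> 1" if "i < j" for i j using vA[OF less_imp_le[OF that]] that by (auto simp: A_def split: if_splits)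
    qed
    then have "0 < cint_PD m q v"
      using sp pos_def_det_pos[of "sym_of v"] by (simp add: cint_PD_def PD_set_iff cint_def)
    with sp show "v \<in> {v \<in> space (LP upper_idx). ennreal (cint_PD m q v) \<noteq> 0}" by simp
  qed
  moreover have "{v \<in> space (LP upper_idx). ennreal (cint_PD m q v) \<noteq> 0} \<in> sets (LP (upper_idx :: ('n \<times> 'n) set))"
    using measurable_compose[OF cint_PD_measurable measurable_ennreal] by measurable
  ultimately have "emeasure (LP upper_idx) (Pi\<^sub>E upper_idx A) \<le> emeasure (LP upper_idx) {v \<in> space (LP (upper_idx :: ('n \<times> 'n) set)). ennreal (cint_PD m q v) \<noteq> 0}"
    by (rule emeasure_mono)
  moreover have "emeasure (LP upper_idx) (Pi\<^sub>E upper_idx A) = 1"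
    using A by (subst lborel_product.emeasure_PiM) auto
  ultimately show False by (simp add: null)
qed

text \<open>The density is the normalised integrand at T B T times the Jacobian of B -> T B T. The
  powers of det \<Psi> match because the Jacobian contributes exponent -(p + 1)/2, which cancels the
  part (p + 1)/2 of the exponent of det (T B T) and leaves qm/2.\<close>

lemma piw_density_eq:
  fixes Psi :: "real^'n::{finite,linorder}^'n::{finite,linorder}"
  assumes Psi: "pos_def Psi" and v: "v \<in> space (LP upper_idx)"
  defines "T \<equiv> matrix_inv (msqrt Psi)"
  shows "piw_density Psi m q v * indicator PD_set v =
    1 / enn2real (cmq m q TYPE('n)) * (\<bar>det T\<bar> ^ (CARD('n) + 1)) *
      cint_PD m q (\<lambda>p\<in>upper_idx. (T ** sym_of v ** transpose T) $ fst p $ snd p)"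
proof -
  define S where "S = msqrt Psi"
  let ?v' = "\<lambda>p\<in>upper_idx. (T ** sym_of v ** transpose T) $ fst p $ snd p"
  let ?B = "sym_of v"
  have S: "pos_def S" "S ** S = Psi" unfolding S_def by (rule msqrt_pos_def[OF Psi])+
  have T: "pos_def T" unfolding T_def S_def[symmetric] by (rule pos_def_matrix_inv[OF S(1)])
  have ST: "S ** T = mat 1" unfolding T_def S_def[symmetric] by (rule matrix_inv[OF pos_def_invertible[OF S(1)]])
  have trT: "transpose T = T" and trS: "transpose S = S" using T S(1) by (auto simp: pos_def_def)
  have sym': "sym_of ?v' = T ** ?B ** T"
    unfolding trT by (rule sym_of_upper) (auto simp: upper_idx_def matrix_transpose_mul trT transpose_sym_of matrix_mul_assoc)
  have sp': "?v' \<in> space (LP upper_idx)" by (auto simp: space_PiM)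
  have pd: "pos_def (T ** ?B ** T) \<longleftrightarrow> pos_def ?B"
  proof
    assume "pos_def (T ** ?B ** T)"
    from pos_def_congruence[OF this pos_def_invertible[OF S(1)]]
    have "pos_def (S ** (T ** ?B ** T) ** S)" by (simp add: trS)
    moreover have "S ** (T ** ?B ** T) ** S = ?B"
    proof -
      have "T ** S = mat 1" using ST matrix_left_right_inverse by blast
      have "S ** (T ** ?B ** T) ** S = (S ** T) ** ?B ** (T ** S)" by (simp only: matrix_mul_assoc)
      then show ?thesis by (simp only: ST \<open>T ** S = mat 1\<close> matrix_mul_lid matrix_mul_rid)
    qed
    ultimately show "pos_def ?B" by simp
  next
    assume "pos_def ?B"
    from pos_def_congruence[OF this pos_def_invertible[OF T]] show "pos_def (T ** ?B ** T)" by (simp add: trT)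
  qed
  show ?thesis
  proof (cases "pos_def ?B")
    case False
    then show ?thesis by (simp add: cint_PD_def PD_set_iff sym' pd)
  next
    case True
    let ?a = "real q * m / 2 + real CARD('n) / 2 + 1 / 2"
    have dB: "0 < det ?B" and dP: "0 < det Psi" and dT: "0 < det T" and dS: "0 < det S"
      using True Psi T S(1) by (auto intro: pos_def_det_pos)
    have "det S * det T = 1" using ST by (metis det_I det_mul)
    moreover have PS: "det Psi = det S ^ 2" using S(2) by (metis det_mul power2_eq_square)
    ultimately have TP: "det T ^ 2 = inverse (det Psi)"
      by (metis inverse_unique power_mult_distrib power_one)
    have "det T = sqrt (inverse (det Psi))" using TP dT by (metis less_imp_le real_sqrt_unique)
    then have "det T = det Psi powr (- (1/2))"
      using dP by (simp add: powr_half_sqrt powr_minus real_sqrt_inverse)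
    then have pT: "\<bar>det T\<bar> ^ (CARD('n) + 1) = det Psi powr (- (real CARD('n) + 1) / 2)"
    proof -
      have "\<bar>det T\<bar> ^ (CARD('n) + 1) = det T powr real (CARD('n) + 1)"
        using dT by (simp only: powr_realpow abs_of_pos)
      also have "\<dots> = det Psi powr (- (1/2) * real (CARD('n) + 1))"
        by (simp only: \<open>det T = det Psi powr (- (1/2))\<close> powr_powr)
      also have "- (1/2) * real (CARD('n) + 1) = - (real CARD('n) + 1) / 2" by (simp add: field_simps)
      finally show ?thesis .
    qed
    have dd: "det (T ** ?B ** T) = det ?B * inverse (det Psi)"
      by (simp add: det_mul TP[symmetric] power2_eq_square)
    have "?v' \<in> PD_set" using sp' True by (simp add: PD_set_iff sym' pd)
    moreover have "- (real q * m / 2) - real CARD('n) / 2 - 1 / 2 = - ?a" by simp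
    ultimately have "cint_PD m q ?v' = exp (- trace (mpow (matrix_inv (T ** ?B ** T)) q) / 2) * (det ?B * inverse (det Psi)) powr (- ?a)"
      by (simp only: cint_PD_def cint_def sym' dd indicator_simps mult_1_right)
    also have "(det ?B * inverse (det Psi)) powr (- ?a) = det ?B powr (- ?a) * det Psi powr ?a"
      using dB dP powr_minus[of "det Psi" ?a] by (simp only: powr_mult inverse_powr less_imp_le inverse_inverse_eq)
    finally have c: "cint_PD m q ?v' = exp (- trace (mpow (matrix_inv (T ** ?B ** T)) q) / 2) * (det ?B powr (- ?a) * det Psi powr ?a)" .
    have "det Psi powr (- (real CARD('n) + 1) / 2) * det Psi powr ?a = det Psi powr (real q * m / 2)"
      unfolding powr_add[symmetric] by (rule arg_cong[where f="\<lambda>t. det Psi powr t"]) (simp add: field_simps)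
    then have main: "\<bar>det T\<bar> ^ (CARD('n) + 1) * cint_PD m q ?v' =
        exp (- trace (mpow (matrix_inv (T ** ?B ** T)) q) / 2) * (det ?B powr (- ?a) * det Psi powr (real q * m / 2))"
      unfolding c pT by (simp add: mult_ac)
    have "piw_density Psi m q v = 1 / enn2real (cmq m q TYPE('n)) *
        (exp (- trace (mpow (matrix_inv (T ** ?B ** T)) q) / 2) * (det ?B powr (- ?a) * det Psi powr (real q * m / 2)))"
      unfolding piw_density_def T_def powr_minus[of "det ?B" ?a] by (simp only: divide_inverse mult_ac)
    moreover have "v \<in> PD_set" using True v by (simp add: PD_set_iff)
    ultimately show ?thesis by (simp only: main[symmetric] indicator_simps mult_1_right mult.assoc)
  qed
qed

theorem theorem1:
  fixes Psi :: "real^'n::{finite,linorder}^'n::{finite,linorder}" and m :: real and q :: nat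
  assumes "pos_def Psi" and "m \<ge> real CARD('n::{finite,linorder})" and "q \<ge> 1"
  shows "cmq m q TYPE('n::{finite,linorder}) < \<infinity> \<and> cmq m q TYPE('n::{finite,linorder}) > 0
    \<and> (\<lambda>v. piw_density Psi m q v * indicator (PD_set :: ('n::{finite,linorder} \<times> 'n::{finite,linorder} \<Rightarrow> real) set) v) \<in> borel_measurable sym_lebesgue
    \<and> (\<forall>v\<in>(PD_set :: ('n::{finite,linorder} \<times> 'n::{finite,linorder} \<Rightarrow> real) set). piw_density Psi m q v \<ge> 0)
    \<and> (\<integral>\<^sup>+ v. ennreal (piw_density Psi m q v) * indicator (PD_set :: ('n::{finite,linorder} \<times> 'n::{finite,linorder} \<Rightarrow> real) set) v \<partial>sym_lebesgue) = 1"
proof -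
  let ?c = "cmq m q TYPE('n)"
  define T where "T = matrix_inv (msqrt Psi)"
  define L where "L v = (\<lambda>p\<in>upper_idx. (T ** sym_of v ** transpose T) $ fst p $ snd p)" for v
  define J where "J = \<bar>det T\<bar> ^ (CARD('n) + 1)"
  have fin: "?c < \<infinity>" by (rule cmq_finite[OF assms(2,3)])
  have pos: "0 < ?c" by (rule cmq_pos)
  have "det T \<noteq> 0"
    using pos_def_det_pos[OF pos_def_matrix_inv[OF msqrt_pos_def(1)[OF assms(1)]]] by (simp add: T_def)
  have eq: "piw_density Psi m q v * indicator PD_set v = 1 / enn2real ?c * J * cint_PD m q (L v)"
    if "v \<in> space (LP upper_idx)" for v
    unfolding J_def L_def T_def by (rule piw_density_eq[OF assms(1) that])
  have "L \<in> LP upper_idx \<rightarrow>\<^sub>M LP upper_idx"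
    unfolding L_def[abs_def] measurable_lborel2[symmetric]
    by (intro measurable_restrict) (auto intro!: borel_measurable_matrix_nth borel_measurable_matrix_mult)
  from measurable_compose[OF this cint_PD_measurable]
  have mL: "(\<lambda>v. cint_PD m q (L v)) \<in> borel_measurable (LP upper_idx)" .
  then have "(\<lambda>v. 1 / enn2real ?c * J * cint_PD m q (L v)) \<in> borel_measurable (LP upper_idx)" by simp
  then have meas: "(\<lambda>v. piw_density Psi m q v * indicator PD_set v) \<in> borel_measurable (LP upper_idx)"
    using eq by (simp cong: measurable_cong)
  have "(\<integral>\<^sup>+v. ennreal (piw_density Psi m q v) * indicator PD_set v \<partial>LP upper_idx) =
      (\<integral>\<^sup>+v. ennreal (1 / enn2real ?c) * (ennreal J * ennreal (cint_PD m q (L v))) \<partial>LP upper_idx)"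
  proof (rule nn_integral_cong)
    fix v :: "'n \<times> 'n \<Rightarrow> real" assume v: "v \<in> space (LP upper_idx)"
    have "ennreal (piw_density Psi m q v) * indicator PD_set v = ennreal (piw_density Psi m q v * indicator PD_set v)"
      by (simp split: split_indicator)
    also have "\<dots> = ennreal (1 / enn2real ?c) * (ennreal J * ennreal (cint_PD m q (L v)))"
      unfolding eq[OF v] by (simp add: J_def cint_PD_def cint_def mult.assoc flip: ennreal_mult)
    finally show "ennreal (piw_density Psi m q v) * indicator PD_set v =
        ennreal (1 / enn2real ?c) * (ennreal J * ennreal (cint_PD m q (L v)))" .
  qed
  also have "\<dots> = ennreal (1 / enn2real ?c) * (ennreal J * (\<integral>\<^sup>+v. ennreal (cint_PD m q (L v)) \<partial>LP upper_idx))"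
    using mL by (simp add: nn_integral_cmult)
  \<comment> \<open>Substitution by the congruence with \<open>T\<close>: \<open>J\<close> is its
    Jacobian, so the integral no longer depends on \<open>Psi\<close>.\<close>
  also have "ennreal J * (\<integral>\<^sup>+v. ennreal (cint_PD m q (L v)) \<partial>LP upper_idx) = ?c"
    unfolding J_def L_def cmq_eq
    by (rule nn_integral_congruence[OF \<open>det T \<noteq> 0\<close>, of "\<lambda>v. ennreal (cint_PD m q v)"]) (use cint_PD_measurable in measurable)
  also have "ennreal (1 / enn2real ?c) * ?c = 1"
  proof -
    \<comment> \<open>Since \<open>enn2real\<close> sends infinity to 0, both finiteness and
      positivity are required for the prefactor to be a true reciprocal.\<close>
    have "0 < enn2real ?c" using fin pos by (simp add: enn2real_positive_iff)
    moreover have "?c = ennreal (enn2real ?c)" using fin by (simp add: ennreal_enn2real)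
    ultimately show ?thesis by (metis ennreal_1 ennreal_mult' less_imp_le nonzero_eq_divide_eq order_less_irrefl zero_le_divide_1_iff)
  qed
  finally have int: "(\<integral>\<^sup>+v. ennreal (piw_density Psi m q v) * indicator PD_set v \<partial>LP upper_idx) = 1" .
  have "\<forall>v\<in>(PD_set :: ('n \<times> 'n \<Rightarrow> real) set). 0 \<le> piw_density Psi m q v"
    by (simp add: piw_density_def)
  with fin pos meas int show ?thesis by (simp add: sym_lebesgue_def)
qed

end
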